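(* Let $\varphi:\mathbb{H}^n\to\mathbb{R}$ be an $H$-convex function. The following conditions are equivalent: (a) $\varphi$ is an $H$-differentiable function, with bounded $H$-sections and controlled $H$-slope; (b) $\varphi$ has round $H$-sections. Moreover, the constant $K_0$ in the definition of round $H$-sections and the constant $K_1$ in the definition of controlled $H$-slope are related, and they depend only on $\varphi$.
   Context: Heisenberg group: $\mathbb{H}^n=\mathbb{R}^n\times\mathbb{R}^n\times\mathbb{R}$ with group law $(x,y,t)\circ(x',y',t')=(x+x',y+y',t+t'+2(x'\cdot y-x\cdot y'))$, neutral element $e$, dilations $\delta_\lambda(x,y,t)=(\lambda x,\lambda y,\lambda^2t)$, and $\mathrm{Pr}_1(x,y,t)=(x,y)\in\mathbb{R}^{2n}$. The first layer $V_1$ of the Lie algebra is identified with $\mathbb{R}^{2n}$, and $\exp v=(v,0)$ for $v\in V_1$. Gauge norm $N(x,y,t)=((\|x\|^2+\|y\|^2)^2+t^2)^{1/4}$, $\|\xi\|_g=N(\xi)$, $d_g(\xi,\xi')=N((\xi')^{-1}\circ\xi)$, $B_g(\xi_0,r)=\{\xi:\ d_g(\xi_0,\xi)\le r\}$. The horizontal plane at $\xi_0=(x_0,y_0,t_0)$ is $H_{\xi_0}=\{(x,y,t):\ t=t_0+2(y_0\cdot x-x_0\cdot y)\}=\{\xi_0\circ\exp v:\ v\in V_1\}$. $H$-convexity: $\varphi:\mathbb{H}^n\to\mathbb{R}$ is $H$-convex if $\varphi(\xi_1\circ\delta_\lambda(\xi_1^{-1}\circ\xi_2))\le(1-\lambda)\varphi(\xi_1)+\lambda\varphi(\xi_2)$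 for all $\xi_1\in\mathbb{H}^n$, $\xi_2\in H_{\xi_1}$, $\lambda\in[0,1]$. Horizontal subdifferential: $\partial_H\varphi(\xi_0)=\{p\in\mathbb{R}^{2n}:\ \varphi(\xi)\ge\varphi(\xi_0)+p\cdot(\mathrm{Pr}_1(\xi)-\mathrm{Pr}_1(\xi_0))\ \forall\xi\in H_{\xi_0}\}$ (nonempty at every point when $\varphi$ is $H$-convex). $\varphi$ is $H$-differentiable at $\xi$ if there is $\nabla_H\varphi(\xi)\in\mathbb{R}^{2n}$ with $\varphi(\xi\circ\xi')=\varphi(\xi)+\nabla_H\varphi(\xi)\cdot\mathrm{Pr}_1(\xi')+o(\|\xi'\|_g)$ as $\xi'\to e$; it is $H$-differentiable if this holds at every $\xi$. $H$-sections: for $\varphi$ $H$-convex, $\xi_0\in\mathbb{H}^n$, $p_0\in\partial_H\varphi(\xi_0)$, $s>0$, $S_\varphi^H(\xi_0,p_0,s)=\{\xi\in H_{\xi_0}:\ \varphi(\xi)-\varphi(\xi_0)-p_0\cdot(\mathrm{Pr}_1(\xi)-\mathrm{Pr}_1(\xi_0))<s\}$. "Bounded $H$-sections" means all these sets are bounded. Round $H$-sections: an $H$-convex $\varphi$ has round $H$-sections if there is a constant $K_0\in(0,1)$ such that for every $\xi\in\mathbb{H}^n$, $p\in\partial_H\varphi(\xi)$, $s>0$ there is $R>0$ with $B_g(\xi,K_0R)\cap H_\xi\subset S_\varphi^H(\xi,p,s)\subset B_g(\xi,R)\cap H_\xi$. For $\varphi$ $H$-differentiable, $m_\varphi^H(\xi,r)$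 and $M_\varphi^H(\xi,r)$ are respectively the minimum and the maximum of $\varphi(\xi')-\varphi(\xi)-\nabla_H\varphi(\xi)\cdot(\mathrm{Pr}_1(\xi')-\mathrm{Pr}_1(\xi))$ over $\{\xi'\in H_\xi:\ d_g(\xi,\xi')=r\}$. Controlled $H$-slope: an $H$-convex $\varphi$ has controlled $H$-slope if it is $H$-differentiable and there is a constant $K_1>0$ with $M_\varphi^H(\xi,r)\le K_1m_\varphi^H(\xi,r)$ for every $\xi\in\mathbb{H}^n$ and $r>0$. *)

theory Defs
  imports "HOL-Analysis.Analysis" "HOL-Library.Landau_Symbols"
begin

section \<open>The Heisenberg group\<close>

text \<open>
  The dimension $n \ge 1$ is the cardinality of the index type. The space $R^{2n}$, which is
  also the first layer of the Lie algebra, is the product of two copies of $R^n$; its inner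
  product and norm are the Euclidean ones of the product type.
\<close>

type_synonym 'n hlayer = "(real^'n) \<times> (real^'n)"
type_synonym 'n heis = "(real^'n) \<times> (real^'n) \<times> real"

fun hmult :: "'n::finite heis \<Rightarrow> 'n heis \<Rightarrow> 'n heis"  (infixl "\<odot>" 70) where
  "(x, y, t) \<odot> (x', y', t') = (x + x', y + y', t + t' + 2 * (x' \<bullet> y - x \<bullet> y'))"

definition hunit :: "'n::finite heis" where
  "hunit = (0, 0, 0)"

fun hinv :: "'n::finite heis \<Rightarrow> 'n heis" where
  "hinv (x, y, t) = (- x, - y, - t)"

lemma hmult_hunit: "hunit \<odot> \<xi> = \<xi>" "\<xi> \<odot> hunit = \<xi>"
  by (cases \<xi>; simp add: hunit_def)+

lemma hmult_assoc: "(\<xi> \<odot> \<eta>) \<odot> \<zeta> = \<xi> \<odot> (\<eta> \<odot> \<zeta>)"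
  by (cases \<xi>; cases \<eta>; cases \<zeta>) (simp add: algebra_simps)

lemma hmult_hinv: "hinv \<xi> \<odot> \<xi> = hunit" "\<xi> \<odot> hinv \<xi> = hunit"
  by (cases \<xi>; simp add: hunit_def inner_commute)+

fun hdil :: "real \<Rightarrow> 'n::finite heis \<Rightarrow> 'n heis" where
  "hdil l (x, y, t) = (l *\<^sub>R x, l *\<^sub>R y, l\<^sup>2 * t)"

fun Pr1 :: "'n::finite heis \<Rightarrow> 'n hlayer" where
  "Pr1 (x, y, t) = (x, y)"

fun hexp :: "'n::finite hlayer \<Rightarrow> 'n heis" where
  "hexp (x, y) = (x, y, 0)"

fun gauge_norm :: "'n::finite heis \<Rightarrow> real" where
  "gauge_norm (x, y, t) = root 4 (((norm x)\<^sup>2 + (norm y)\<^sup>2)\<^sup>2 + t\<^sup>2)"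

definition gauge_dist :: "'n::finite heis \<Rightarrow> 'n heis \<Rightarrow> real" where
  "gauge_dist \<xi> \<xi>' = gauge_norm (hinv \<xi>' \<odot> \<xi>)"

definition gauge_ball :: "'n::finite heis \<Rightarrow> real \<Rightarrow> 'n heis set" where
  "gauge_ball \<xi>0 r = {\<xi>. gauge_dist \<xi>0 \<xi> \<le> r}"

fun hplane :: "'n::finite heis \<Rightarrow> 'n heis set" where
  "hplane (x0, y0, t0) = {(x, y, t). t = t0 + 2 * (y0 \<bullet> x - x0 \<bullet> y)}"

lemma hplane_eq_range_hexp: "hplane \<xi>0 = range (\<lambda>v. \<xi>0 \<odot> hexp v)"
proof (cases \<xi>0)
  case (fields x0 y0 t0)
  have "(x, y, t) \<in> range (\<lambda>v. \<xi>0 \<odot> hexp v)" if "t = t0 + 2 * (y0 \<bullet> x - x0 \<bullet> y)" for x y t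
    by (rule range_eqI[of _ _ "(x - x0, y - y0)"])
      (simp add: fields that inner_diff inner_commute)
  moreover have "\<xi>0 \<odot> hexp v \<in> hplane \<xi>0" for v
    by (cases v) (simp add: fields inner_add inner_commute)
  ultimately show ?thesis
    unfolding fields by fastforce
qed


section \<open>H-convexity, H-subdifferential and H-differentiability\<close>

definition H_convex :: "('n::finite heis \<Rightarrow> real) \<Rightarrow> bool" where
  "H_convex \<phi> \<longleftrightarrow>
    (\<forall>\<xi>1. \<forall>\<xi>2\<in>hplane \<xi>1. \<forall>l\<in>{0..1}.
      \<phi> (\<xi>1 \<odot> hdil l (hinv \<xi>1 \<odot> \<xi>2)) \<le> (1 - l) * \<phi> \<xi>1 + l * \<phi> \<xi>2)"

definition H_subdiff :: "('n::finite heis \<Rightarrow> real) \<Rightarrow> 'n heis \<Rightarrow> 'n hlayer set" where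
  "H_subdiff \<phi> \<xi>0 = {p. \<forall>\<xi>\<in>hplane \<xi>0. \<phi> \<xi> \<ge> \<phi> \<xi>0 + p \<bullet> (Pr1 \<xi> - Pr1 \<xi>0)}"

text \<open>
  The increment \<open>\<xi>'\<close> ranges over a full neighbourhood of the neutral element, not only over
  horizontal directions. The product topology used here is the one induced by the gauge distance.
\<close>

definition has_H_gradient :: "('n::finite heis \<Rightarrow> real) \<Rightarrow> 'n hlayer \<Rightarrow> 'n heis \<Rightarrow> bool" where
  "has_H_gradient \<phi> p \<xi> \<longleftrightarrow>
    (\<lambda>\<xi>'. \<phi> (\<xi> \<odot> \<xi>') - \<phi> \<xi> - p \<bullet> Pr1 \<xi>') \<in> o[at hunit](gauge_norm)"

definition H_differentiable :: "('n::finite heis \<Rightarrow> real) \<Rightarrow> bool" where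
  "H_differentiable \<phi> \<longleftrightarrow> (\<forall>\<xi>. \<exists>p. has_H_gradient \<phi> p \<xi>)"

text \<open>Where \<open>\<phi>\<close> is H-differentiable the H-gradient is unique, see \<open>has_H_gradient_unique\<close>.\<close>

definition H_gradient :: "('n::finite heis \<Rightarrow> real) \<Rightarrow> 'n heis \<Rightarrow> 'n hlayer" where
  "H_gradient \<phi> \<xi> = (THE p. has_H_gradient \<phi> p \<xi>)"

lemma gauge_norm_hexp: "gauge_norm (hexp v) = norm v"
proof (cases v)
  case (Pair x y)
  have "(norm v) ^ 4 = ((norm v)\<^sup>2)\<^sup>2"
    by (simp flip: power_mult)
  then have "((norm x)\<^sup>2 + (norm y)\<^sup>2)\<^sup>2 = (norm v) ^ 4"
    by (simp add: Pair norm_Pair)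
  then show ?thesis
    by (simp add: Pair real_root_power_cancel)
qed

lemma has_H_gradient_unique:
  assumes "has_H_gradient \<phi> p \<xi>" "has_H_gradient \<phi> q \<xi>"
  shows "p = q"
proof (rule ccontr)
  assume "p \<noteq> q"
  define w where "w = p - q"
  have w: "w \<noteq> 0" using \<open>p \<noteq> q\<close> by (simp add: w_def)
  have "(\<lambda>\<xi>'. (\<phi> (\<xi> \<odot> \<xi>') - \<phi> \<xi> - q \<bullet> Pr1 \<xi>') - (\<phi> (\<xi> \<odot> \<xi>') - \<phi> \<xi> - p \<bullet> Pr1 \<xi>'))
      \<in> o[at hunit](gauge_norm)"
    using assms unfolding has_H_gradient_def by (rule_tac sum_in_smallo(2))
  then have o: "(\<lambda>\<xi>'. w \<bullet> Pr1 \<xi>') \<in> o[at hunit](gauge_norm)"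
    by (simp add: w_def inner_diff_left)
  have lim: "filterlim (\<lambda>h::real. hexp (h *\<^sub>R w)) (at hunit) (at_right 0)"
  proof (cases w)
    case (Pair a b)
    have "((\<lambda>h::real. (h *\<^sub>R a, h *\<^sub>R b, 0::real)) \<longlongrightarrow> (0 *\<^sub>R a, 0 *\<^sub>R b, 0)) (at_right 0)"
      by (intro tendsto_intros)
    moreover have "\<forall>\<^sub>F h::real in at_right 0. (h *\<^sub>R a, h *\<^sub>R b, 0::real) \<noteq> (0, 0, 0)"
      using w by (auto simp: Pair eventually_at_filter zero_prod_def)
    ultimately show ?thesis
      by (simp add: Pair filterlim_at hunit_def eventually_mono)
  qed
  have pr: "Pr1 (hexp v) = v" for v :: "'a hlayer" by (cases v) simp
  have "(\<lambda>h::real. h * (w \<bullet> w)) \<in> o[at_right 0](\<lambda>h. norm (h *\<^sub>R w))"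
    using landau_o.small.compose[OF o lim] by (simp only: pr gauge_norm_hexp inner_scaleR_right)
  then have "\<forall>\<^sub>F h::real in at_right 0. \<bar>h * (w \<bullet> w)\<bar> \<le> norm w / 2 * \<bar>norm (h *\<^sub>R w)\<bar>"
    using landau_o.smallD[of _ "at_right 0" _ "norm w / 2"] w by fastforce
  moreover have "\<forall>\<^sub>F h::real in at_right 0. 0 < h"
    by (simp add: eventually_at_filter)
  ultimately have "\<forall>\<^sub>F h::real in at_right 0. False"
  proof eventually_elim
    case (elim h)
    then have "h * (norm w)\<^sup>2 \<le> h * (norm w)\<^sup>2 / 2"
      by (simp add: power2_norm_eq_inner abs_mult) (simp add: power2_eq_square flip: power2_norm_eq_inner)
    then show False using w elim by (simp add: field_simps)
  qed
  then show False by simp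
qed


section \<open>H-sections\<close>

definition H_section ::
    "('n::finite heis \<Rightarrow> real) \<Rightarrow> 'n heis \<Rightarrow> 'n hlayer \<Rightarrow> real \<Rightarrow> 'n heis set" where
  "H_section \<phi> \<xi>0 p0 s =
    {\<xi> \<in> hplane \<xi>0. \<phi> \<xi> - \<phi> \<xi>0 - p0 \<bullet> (Pr1 \<xi> - Pr1 \<xi>0) < s}"

definition bounded_H_sections :: "('n::finite heis \<Rightarrow> real) \<Rightarrow> bool" where
  "bounded_H_sections \<phi> \<longleftrightarrow>
    (\<forall>\<xi>. \<forall>p\<in>H_subdiff \<phi> \<xi>. \<forall>s>0. bounded (H_section \<phi> \<xi> p s))"

definition round_H_sections_with :: "real \<Rightarrow> ('n::finite heis \<Rightarrow> real) \<Rightarrow> bool" where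
  "round_H_sections_with K0 \<phi> \<longleftrightarrow>
    (\<forall>\<xi>. \<forall>p\<in>H_subdiff \<phi> \<xi>. \<forall>s>0. \<exists>R>0.
      gauge_ball \<xi> (K0 * R) \<inter> hplane \<xi> \<subseteq> H_section \<phi> \<xi> p s \<and>
      H_section \<phi> \<xi> p s \<subseteq> gauge_ball \<xi> R \<inter> hplane \<xi>)"

definition round_H_sections :: "('n::finite heis \<Rightarrow> real) \<Rightarrow> bool" where
  "round_H_sections \<phi> \<longleftrightarrow> (\<exists>K0. 0 < K0 \<and> K0 < 1 \<and> round_H_sections_with K0 \<phi>)"


section \<open>Controlled H-slope\<close>

text \<open>
  The extrema below are used only for H-differentiable, hence continuous, \<open>\<phi>\<close> and for \<open>r > 0\<close>;
  the set is then compact and nonempty, so \<open>INF\<close> and \<open>SUP\<close> are the minimum and the maximum.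
\<close>

definition hsphere :: "'n::finite heis \<Rightarrow> real \<Rightarrow> 'n heis set" where
  "hsphere \<xi> r = {\<xi>' \<in> hplane \<xi>. gauge_dist \<xi> \<xi>' = r}"

definition m_H :: "('n::finite heis \<Rightarrow> real) \<Rightarrow> 'n heis \<Rightarrow> real \<Rightarrow> real" where
  "m_H \<phi> \<xi> r = (INF \<xi>'\<in>hsphere \<xi> r. \<phi> \<xi>' - \<phi> \<xi> - H_gradient \<phi> \<xi> \<bullet> (Pr1 \<xi>' - Pr1 \<xi>))"

definition M_H :: "('n::finite heis \<Rightarrow> real) \<Rightarrow> 'n heis \<Rightarrow> real \<Rightarrow> real" where
  "M_H \<phi> \<xi> r = (SUP \<xi>'\<in>hsphere \<xi> r. \<phi> \<xi>' - \<phi> \<xi> - H_gradient \<phi> \<xi> \<bullet> (Pr1 \<xi>' - Pr1 \<xi>))"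

definition controlled_H_slope_with :: "real \<Rightarrow> ('n::finite heis \<Rightarrow> real) \<Rightarrow> bool" where
  "controlled_H_slope_with K1 \<phi> \<longleftrightarrow>
    H_differentiable \<phi> \<and> (\<forall>\<xi>. \<forall>r>0. M_H \<phi> \<xi> r \<le> K1 * m_H \<phi> \<xi> r)"

definition controlled_H_slope :: "('n::finite heis \<Rightarrow> real) \<Rightarrow> bool" where
  "controlled_H_slope \<phi> \<longleftrightarrow> (\<exists>K1>0. controlled_H_slope_with K1 \<phi>)"

end

theory Submission
  imports Defs
begin

text \<open>
  An H-convex function is bounded above near each point: vertical segments are controlled by two
  horizontal lines, and the rest by convexity on isotropic planes. Reflection gives lower bounds, and
  decomposing group elements into five horizontal steps gives continuity. Then the directional
  derivatives in horizontal directions are sublinear (by a zigzag path), so by Hahn--Banach each of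
  them is attained by an H-subgradient \<open>p\<close>.

  Let \<open>E v\<close> be the excess of \<open>\<phi>\<close> at \<open>\<xi> \<odot> hexp v\<close> over the plane given by \<open>p\<close>. Roundness says that
  \<open>E u \<le> E w\<close> whenever \<open>norm u \<le> K0 * norm w\<close>. Comparing \<open>v\<close> with \<open>- v\<close> excludes kinks, hence \<open>\<phi>\<close> is
  H-differentiable. Applying roundness at another centre of the same ray shows that \<open>E\<close> grows at most
  polynomially along rays, and both facts together control the slope. Conversely, with \<open>R\<close> the radius
  of a section, convexity along rays puts the ball of radius \<open>R / (K1 + 1)\<close> inside it.
\<close>

section \<open>The group operations and the gauge norm\<close>

lemma hmult_alt: "a \<odot> b = (fst a + fst b, fst (snd a) + fst (snd b),
    snd (snd a) + snd (snd b) + 2 * (fst b \<bullet> fst (snd a) - fst a \<bullet> fst (snd b)))"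
  by (cases a; cases b) simp

lemma hexp_alt: "hexp v = (fst v, snd v, 0)"
  by (cases v) simp

lemma Pr1_alt: "Pr1 \<xi> = (fst \<xi>, fst (snd \<xi>))"
  by (cases \<xi>) simp

lemma gauge_norm_alt:
  "gauge_norm \<xi> = root 4 (((norm (fst \<xi>))\<^sup>2 + (norm (fst (snd \<xi>)))\<^sup>2)\<^sup>2 + (snd (snd \<xi>))\<^sup>2)"
  by (cases \<xi>) simp

lemma hexp_0 [simp]: "hexp 0 = hunit"
  by (simp add: hexp_alt hunit_def)

lemma hmult_hexp_add: "\<xi> \<odot> hexp (s *\<^sub>R v) \<odot> hexp (t *\<^sub>R v) = \<xi> \<odot> hexp ((s + t) *\<^sub>R v)"
  by (simp add: hmult_alt hexp_alt algebra_simps inner_commute)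

lemma hmult_hexp_minus [simp]: "\<xi> \<odot> hexp v \<odot> hexp (- v) = \<xi>"
  using hmult_hexp_add[of \<xi> 1 v "-1"] by (simp add: hmult_hunit)

lemma Pr1_hmult_hexp [simp]: "Pr1 (\<xi> \<odot> hexp v) = Pr1 \<xi> + v"
  by (cases v) (simp add: hmult_alt hexp_alt Pr1_alt)

lemma Pr1_hexp [simp]: "Pr1 (hexp v) = v"
  by (cases v) simp

lemma hinv_hmult_cancel [simp]: "hinv \<xi> \<odot> (\<xi> \<odot> \<eta>) = \<eta>"
  by (simp add: hmult_assoc[symmetric] hmult_hinv hmult_hunit)

lemma hmult_hinv_cancel [simp]: "\<xi> \<odot> (hinv \<xi> \<odot> \<eta>) = \<eta>"
  by (simp add: hmult_assoc[symmetric] hmult_hinv hmult_hunit)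

lemma hdil_hexp: "hdil l (hexp v) = hexp (l *\<^sub>R v)"
  by (cases v) simp

lemma gauge_dist_hexp [simp]: "gauge_dist \<xi> (\<xi> \<odot> hexp v) = norm v"
proof -
  have "hinv (\<xi> \<odot> hexp v) \<odot> \<xi> = hexp (- v)"
    by (metis hinv_hmult_cancel hmult_hexp_minus)
  then show ?thesis
    by (simp add: gauge_dist_def gauge_norm_hexp)
qed

lemma tendsto_hmult [tendsto_intros]:
  assumes "(f \<longlongrightarrow> a) F" "(g \<longlongrightarrow> b) F"
  shows "((\<lambda>x. f x \<odot> g x) \<longlongrightarrow> a \<odot> b) F"
  unfolding hmult_alt by (intro tendsto_intros assms)

lemma tendsto_hexp [tendsto_intros]:
  assumes "(f \<longlongrightarrow> a) F"
  shows "((\<lambda>x. hexp (f x)) \<longlongrightarrow> hexp a) F"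
  unfolding hexp_alt by (intro tendsto_intros assms)

lemma tendsto_Pr1 [tendsto_intros]:
  assumes "(f \<longlongrightarrow> a) F"
  shows "((\<lambda>x. Pr1 (f x)) \<longlongrightarrow> Pr1 a) F"
  unfolding Pr1_alt by (intro tendsto_intros assms)

lemma tendsto_gauge_norm [tendsto_intros]:
  assumes "(f \<longlongrightarrow> a) F"
  shows "((\<lambda>x. gauge_norm (f x)) \<longlongrightarrow> gauge_norm a) F"
  unfolding gauge_norm_alt by (intro tendsto_intros assms)

lemma gauge_norm_nonneg: "0 \<le> gauge_norm \<xi>"
  by (simp add: gauge_norm_alt)

lemma norm_Pr1_le: "norm (Pr1 \<xi>) \<le> gauge_norm \<xi>"
proof (cases \<xi>)
  case (fields x y t)
  have "norm (x, y) = root 4 (((norm x)\<^sup>2 + (norm y)\<^sup>2)\<^sup>2 + 0\<^sup>2)"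
    using gauge_norm_hexp[of "(x, y)"] by simp
  also have "\<dots> \<le> gauge_norm \<xi>"
    by (simp add: fields del: real_root_le_iff) (rule real_root_le_mono; simp)
  finally show ?thesis by (simp add: fields)
qed

text \<open>With \<open>norm_Pr1_le\<close>, this makes the gauge norm dominate the length of every
  step of the horizontal decomposition below. The height has degree two under dilations, hence the
  root.\<close>

lemma sqrt_height_le: "sqrt \<bar>snd (snd \<xi>)\<bar> \<le> gauge_norm \<xi>"
proof (cases \<xi>)
  case (fields x y t)
  have "(sqrt \<bar>t\<bar>) ^ 4 = ((sqrt \<bar>t\<bar>)\<^sup>2)\<^sup>2"
    using power_mult[of "sqrt \<bar>t\<bar>" 2 2] by simp
  then have "sqrt \<bar>t\<bar> = root 4 (t\<^sup>2)"
    by (intro real_root_pos_unique[symmetric]) auto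
  also have "\<dots> \<le> gauge_norm \<xi>"
    by (simp add: fields)
  finally show ?thesis by (simp add: fields)
qed

section \<open>Convexity along horizontal lines\<close>

lemma H_convexD:
  assumes "H_convex \<phi>" "0 \<le> l" "l \<le> 1"
  shows "\<phi> (\<xi> \<odot> hexp (l *\<^sub>R v)) \<le> (1 - l) * \<phi> \<xi> + l * \<phi> (\<xi> \<odot> hexp v)"
proof -
  have "\<xi> \<odot> hexp v \<in> hplane \<xi>" by (auto simp: hplane_eq_range_hexp)
  then have "\<phi> (\<xi> \<odot> hdil l (hinv \<xi> \<odot> (\<xi> \<odot> hexp v))) \<le> (1 - l) * \<phi> \<xi> + l * \<phi> (\<xi> \<odot> hexp v)"
    using assms unfolding H_convex_def by fastforce
  then show ?thesis by (simp add: hdil_hexp)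
qed

text \<open>
  The hypothesis on \<open>\<gamma>\<close> holds for affine parametrisations of horizontal lines and, more generally,
  of translates of isotropic subspaces of the first layer.
\<close>

lemma H_convex_convex_on:
  assumes \<phi>: "H_convex \<phi>"
    and \<gamma>: "\<And>l x y. \<gamma> ((1 - l) *\<^sub>R x + l *\<^sub>R y) = \<gamma> x \<odot> hexp (l *\<^sub>R w x y)"
  shows "convex_on UNIV (\<lambda>x. \<phi> (\<gamma> x))"
proof (rule convex_onI)
  fix t :: real and x y assume t: "0 < t" "t < 1"
  have "\<gamma> y = \<gamma> x \<odot> hexp (w x y)" using \<gamma>[of 1 x y] by simp
  then show "\<phi> (\<gamma> ((1 - t) *\<^sub>R x + t *\<^sub>R y)) \<le> (1 - t) * \<phi> (\<gamma> x) + t * \<phi> (\<gamma> y)"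
    unfolding \<gamma> using H_convexD[OF \<phi>, of t "\<gamma> x" "w x y"] t by simp
qed simp

lemma H_convex_line:
  assumes "H_convex \<phi>"
  shows "convex_on UNIV (\<lambda>t. \<phi> (\<xi> \<odot> hexp (t *\<^sub>R v)))"
  by (rule H_convex_convex_on[OF assms, where w = "\<lambda>x y. (y - x) *\<^sub>R v"])
    (simp add: hmult_hexp_add algebra_simps flip: scaleR_left.add scaleR_left_diff_distrib)

text \<open>Steps that change only \<open>x\<close> commute, so they sweep out an isotropic plane;
  the term \<open>2 * (x \<bullet> y)\<close> is the height needed to stay in it.\<close>

lemma H_convex_x:
  assumes "H_convex \<phi>"
  shows "convex_on UNIV (\<lambda>x. \<phi> (x, y, t + 2 * (x \<bullet> y)))"
  by (rule H_convex_convex_on[OF assms, where w = "\<lambda>x x'. (x' - x, 0)"])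
    (simp add: algebra_simps)

lemma H_convex_y:
  assumes "H_convex \<phi>"
  shows "convex_on UNIV (\<lambda>y. \<phi> (x, y, t - 2 * (x \<bullet> y)))"
  by (rule H_convex_convex_on[OF assms, where w = "\<lambda>y y'. (0, y' - y)"])
    (simp add: algebra_simps)

text \<open>Reduces an upper bound for a convex function on a bounded set to finitely many
  vertices.\<close>

lemma bounded_subset_finite_hull:
  fixes A :: "'a::euclidean_space set"
  assumes "bounded A"
  obtains S where "finite S" "A \<subseteq> convex hull S"
proof -
  obtain a where "A \<subseteq> cbox (-a) a"
    using bounded_subset_cbox_symmetric[OF assms] by auto
  moreover obtain S where "finite S" "cbox (-a) a = convex hull S"
    using closed_interval_as_convex_hull by metis
  ultimately show ?thesis using that by auto
qed

section \<open>Local boundedness\<close>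

text \<open>
  A vertical segment consists of midpoints of points of two fixed horizontal lines, on which \<open>\<phi>\<close> is
  an ordinary convex function.
\<close>

lemma H_convex_bdd_vertical:
  fixes \<phi> :: "'n::finite heis \<Rightarrow> real"
  assumes \<phi>: "H_convex \<phi>"
  shows "\<exists>M. \<forall>t. \<bar>t\<bar> \<le> T \<longrightarrow> \<phi> (\<zeta> \<odot> (0, 0, t)) \<le> M"
proof -
  define e :: "real^'n" where "e = axis undefined 1"
  have e: "e \<bullet> e = 1" by (simp add: e_def inner_axis)
  define \<alpha> where "\<alpha> s = \<phi> (\<zeta> \<odot> (0, - e, 0) \<odot> hexp (s *\<^sub>R (- e, 0)))" for s
  define \<beta> where "\<beta> s = \<phi> (\<zeta> \<odot> (0, e, 0) \<odot> hexp (s *\<^sub>R (e, 0)))" for s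
  define M where "M = max (max (\<alpha> (-T)) (\<alpha> T)) (max (\<beta> (-T)) (\<beta> T))"
  have seg: "f s \<le> max (f (-T)) (f T)" if "convex_on UNIV f" "\<bar>s\<bar> \<le> T" for f :: "real \<Rightarrow> real" and s
  proof -
    have "s \<in> convex hull {-T, T}"
      using that(2) by (auto simp: convex_hull_eq_real_cbox closed_segment_eq_real_ivl simp flip: segment_convex_hull)
    then show ?thesis
      using convex_on_convex_hull_bound[of "{-T, T}" f "max (f (-T)) (f T)"] that(1)
        convex_on_subset[of UNIV f] by auto
  qed
  have "\<phi> (\<zeta> \<odot> (0, 0, t)) \<le> M" if "\<bar>t\<bar> \<le> T" for t
  proof -
    \<comment> \<open>The horizontal segment from \<open>a\<close> to
      \<open>a \<odot> hexp v\<close> joins the two lines at the common parameter \<open>s\<close>.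
      Its midpoint lies vertically over \<zeta> at relative height \<open>2 * s\<close>.\<close>
    define s where "s = t / 2"
    define a where "a = \<zeta> \<odot> (0, - e, 0) \<odot> hexp (s *\<^sub>R (- e, 0))"
    define v where "v = ((2 * s) *\<^sub>R e, 2 *\<^sub>R e)"
    have ss: "(s * 2) *\<^sub>R e - s *\<^sub>R e = s *\<^sub>R e" "2 *\<^sub>R e - e = e"
      by (simp_all add: vec_eq_iff)
    have b: "a \<odot> hexp v = \<zeta> \<odot> (0, e, 0) \<odot> hexp (s *\<^sub>R (e, 0))"
      using e by (simp add: a_def v_def hmult_assoc) (simp add: algebra_simps ss)
    have m: "a \<odot> hexp ((1/2) *\<^sub>R v) = \<zeta> \<odot> (0, 0, t)"
      using e by (simp add: a_def v_def hmult_assoc s_def inner_simps)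
    have "\<phi> (\<zeta> \<odot> (0, 0, t)) \<le> (1 - 1/2) * \<alpha> s + 1/2 * \<beta> s"
      using H_convexD[OF \<phi>, of "1/2" a v] unfolding m \<alpha>_def \<beta>_def b[symmetric] a_def[symmetric]
      by simp
    moreover have "\<alpha> s \<le> M" "\<beta> s \<le> M"
      using seg[of \<alpha> s] seg[of \<beta> s] that H_convex_line[OF \<phi>]
      unfolding \<alpha>_def[abs_def] \<beta>_def[abs_def] M_def s_def by fastforce+
    ultimately show ?thesis by simp
  qed
  then show ?thesis by blast
qed

text \<open>The vertical bound holds over finitely many vertices \<open>z\<close> whose hull
  contains the ball of all \<open>x\<close>. Convexity on the isotropic plane through the given
  point carries the largest of these bounds to it.\<close>

lemma H_convex_bdd_above_y:
  fixes \<phi> :: "'n::finite heis \<Rightarrow> real"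
  assumes \<phi>: "H_convex \<phi>"
  shows "\<exists>M. \<forall>x t. norm x \<le> R \<longrightarrow> \<bar>t\<bar> \<le> T \<longrightarrow> \<phi> (x, y, t) \<le> M"
proof -
  obtain S :: "(real^'n) set" where S: "finite S" "cball 0 R \<subseteq> convex hull S"
    using bounded_subset_finite_hull[OF bounded_cball] by blast
  \<comment> \<open>The plane through \<open>(x, y, t)\<close> meets the vertical line over
    \<open>z\<close> at height \<open>\<tau> + 2 * (z \<bullet> y)\<close>, and this range contains
    all such heights.\<close>
  have "\<forall>z. \<exists>M. \<forall>t. \<bar>t\<bar> \<le> T + 2 * R * norm y + 2 * norm z * norm y \<longrightarrow> \<phi> ((z, y, 0) \<odot> (0, 0, t)) \<le> M"
    using H_convex_bdd_vertical[OF \<phi>] by blast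
  then obtain M where M: "\<And>z t. \<bar>t\<bar> \<le> T + 2 * R * norm y + 2 * norm z * norm y \<Longrightarrow> \<phi> (z, y, t) \<le> M z"
    by (simp; metis)
  have "\<phi> (x, y, t) \<le> Max (M ` S)" if "norm x \<le> R" "\<bar>t\<bar> \<le> T" for x t
  proof -
    define \<tau> where "\<tau> = t - 2 * (x \<bullet> y)"
    have "\<bar>x \<bullet> y\<bar> \<le> R * norm y"
      using Cauchy_Schwarz_ineq2[of x y] mult_right_mono[OF that(1) norm_ge_zero[of y]] by linarith
    then have \<tau>: "\<bar>\<tau>\<bar> \<le> T + 2 * R * norm y" using that by (simp add: \<tau>_def)
    have "\<phi> (z, y, \<tau> + 2 * (z \<bullet> y)) \<le> Max (M ` S)" if "z \<in> S" for z
    proof -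
      have "\<phi> (z, y, \<tau> + 2 * (z \<bullet> y)) \<le> M z"
        using \<tau> Cauchy_Schwarz_ineq2[of z y] by (intro M) linarith
      also have "\<dots> \<le> Max (M ` S)" using that S by simp
      finally show ?thesis .
    qed
    then have "\<forall>z\<in>convex hull S. \<phi> (z, y, \<tau> + 2 * (z \<bullet> y)) \<le> Max (M ` S)"
      using H_convex_x[OF \<phi>, of y \<tau>] convex_on_subset
      by (intro convex_on_convex_hull_bound) blast+
    then show ?thesis using S(2) that(1) by (auto simp: \<tau>_def subset_iff dest!: bspec[of _ _ x])
  qed
  then show ?thesis by blast
qed

text \<open>The same vertex argument in the \<open>y\<close> directions: the bound for a fixed
  \<open>y\<close> is now taken at finitely many vertices.\<close>

lemma H_convex_bdd_above:
  fixes \<phi> :: "'n::finite heis \<Rightarrow> real"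
  assumes \<phi>: "H_convex \<phi>" and A: "bounded A"
  shows "\<exists>M. \<forall>\<xi>\<in>A. \<phi> \<xi> \<le> M"
proof -
  obtain R where R: "\<And>\<xi>. \<xi> \<in> A \<Longrightarrow> norm \<xi> \<le> R"
    using A bounded_iff by blast
  obtain S :: "(real^'n) set" where S: "finite S" "cball 0 R \<subseteq> convex hull S"
    using bounded_subset_finite_hull[OF bounded_cball] by blast
  have "\<forall>z. \<exists>M. \<forall>x t. norm x \<le> R \<longrightarrow> \<bar>t\<bar> \<le> R + 2 * R * R + 2 * R * norm z \<longrightarrow> \<phi> (x, z, t) \<le> M"
    using H_convex_bdd_above_y[OF \<phi>] by blast
  then obtain M where M: "\<And>z x t. norm x \<le> R \<Longrightarrow> \<bar>t\<bar> \<le> R + 2 * R * R + 2 * R * norm z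
      \<Longrightarrow> \<phi> (x, z, t) \<le> M z"
    by metis
  have "\<phi> \<xi> \<le> Max (M ` S)" if "\<xi> \<in> A" for \<xi>
  proof (cases \<xi>)
    case (fields x y t)
    define \<tau> where "\<tau> = t + 2 * (x \<bullet> y)"
    have n: "norm x \<le> R" "norm y \<le> R" "\<bar>t\<bar> \<le> R"
      using R[OF that] norm_fst_le[of x "(y, t)"] norm_snd_le[of "(y, t)" x]
        norm_fst_le[of y t] norm_snd_le[of t y] by (simp_all add: fields)
    have "\<bar>x \<bullet> y\<bar> \<le> R * R"
      using Cauchy_Schwarz_ineq2[of x y] mult_mono[OF n(1,2)] norm_ge_zero[of x] n(1) by auto
    then have \<tau>: "\<bar>\<tau>\<bar> \<le> R + 2 * R * R" using n by (simp add: \<tau>_def)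
    have "\<phi> (x, z, \<tau> - 2 * (x \<bullet> z)) \<le> Max (M ` S)" if "z \<in> S" for z
    proof -
      have "\<phi> (x, z, \<tau> - 2 * (x \<bullet> z)) \<le> M z"
        using \<tau> n Cauchy_Schwarz_ineq2[of x z] mult_right_mono[OF n(1) norm_ge_zero[of z]]
        by (intro M) linarith+
      also have "\<dots> \<le> Max (M ` S)" using that S by simp
      finally show ?thesis .
    qed
    then have "\<forall>z\<in>convex hull S. \<phi> (x, z, \<tau> - 2 * (x \<bullet> z)) \<le> Max (M ` S)"
      using H_convex_y[OF \<phi>, of x \<tau>] convex_on_subset
      by (intro convex_on_convex_hull_bound) blast+
    then show ?thesis using S(2) n by (auto simp: \<tau>_def subset_iff fields dest!: bspec[of _ _ y])
  qed
  then show ?thesis by blast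
qed

section \<open>Horizontal decomposition and lower bounds\<close>

text \<open>
  The first four steps form a commutator that produces the height of \<open>\<eta>\<close>. Since \<open>sqrt\<close> is odd,
  \<open>sqrt \<bar>t\<bar> * sqrt t = t\<close> holds for all real \<open>t\<close>.
\<close>

definition hstep1 :: "'n::finite heis \<Rightarrow> 'n hlayer" where
  "hstep1 \<eta> = ((sqrt \<bar>snd (snd \<eta>)\<bar> / 2) *\<^sub>R axis undefined 1, 0)"

definition hstep2 :: "'n::finite heis \<Rightarrow> 'n hlayer" where
  "hstep2 \<eta> = (0, - (sqrt (snd (snd \<eta>)) / 2) *\<^sub>R axis undefined 1)"

text \<open>For a unit vector \<open>e\<close>, the commutator of \<open>(a *\<^sub>R e, 0)\<close>
  and \<open>(0, b *\<^sub>R e)\<close> is vertical of height \<open>- 4 * a * b\<close>. The halves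
  and the minus sign in the steps turn this into the height of \<eta>.\<close>

lemma horizontal_decomposition:
  "hexp (hstep1 \<eta>) \<odot> hexp (hstep2 \<eta>) \<odot> hexp (- hstep1 \<eta>) \<odot> hexp (- hstep2 \<eta>) \<odot> hexp (Pr1 \<eta>) = \<eta>"
proof (cases \<eta>)
  case (fields x y t)
  have "sqrt \<bar>t\<bar> * sqrt t = t"
    by (cases "0 \<le> t") (simp_all add: real_sqrt_minus[of "-t", simplified] abs_if flip: real_sqrt_mult)
  then show ?thesis
    by (simp add: fields hstep1_def hstep2_def inner_axis mult.commute)
qed

lemma norm_hstep1_le: "norm (hstep1 \<eta>) \<le> gauge_norm \<eta>"
  using sqrt_height_le[of \<eta>] gauge_norm_nonneg[of \<eta>] by (simp add: hstep1_def norm_Pair norm_axis_1)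

lemma norm_hstep2_le: "norm (hstep2 \<eta>) \<le> gauge_norm \<eta>"
  using sqrt_height_le[of \<eta>] gauge_norm_nonneg[of \<eta>]
  by (simp add: hstep2_def norm_Pair norm_axis_1 flip: real_sqrt_abs')

lemma tendsto_hstep [tendsto_intros]:
  assumes "(f \<longlongrightarrow> a) F"
  shows "((\<lambda>x. hstep1 (f x)) \<longlongrightarrow> hstep1 a) F" "((\<lambda>x. hstep2 (f x)) \<longlongrightarrow> hstep2 a) F"
  unfolding hstep1_def hstep2_def by (intro tendsto_intros assms; simp)+

lemma hstep_hunit [simp]: "hstep1 hunit = 0" "hstep2 hunit = 0" "Pr1 hunit = 0"
  by (simp_all add: hstep1_def hstep2_def hunit_def zero_prod_def)

lemma bounded_horizontal_neighbourhood:
  fixes B :: "'n::finite heis set"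
  assumes "bounded B"
  shows "bounded {\<zeta> \<odot> hexp v |\<zeta> v. \<zeta> \<in> B \<and> norm v \<le> \<rho>}"
proof -
  have "continuous_on (closure B \<times> cball 0 \<rho>) (\<lambda>x. fst x \<odot> hexp (snd x))"
    unfolding continuous_on_def by (auto intro!: tendsto_eq_intros)
  then have "bounded ((\<lambda>x. fst x \<odot> hexp (snd x)) ` (closure B \<times> cball 0 \<rho>))"
    using assms by (intro compact_imp_bounded compact_continuous_image compact_Times) auto
  moreover have "\<zeta> \<odot> hexp v \<in> (\<lambda>x. fst x \<odot> hexp (snd x)) ` (closure B \<times> cball 0 \<rho>)"
    if "\<zeta> \<in> B" "norm v \<le> \<rho>" for \<zeta> v
    using that closure_subset[of B] by (intro image_eqI[of _ _ "(\<zeta>, v)"]) auto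
  then have "{\<zeta> \<odot> hexp v |\<zeta> v. \<zeta> \<in> B \<and> norm v \<le> \<rho>}
      \<subseteq> (\<lambda>x. fst x \<odot> hexp (snd x)) ` (closure B \<times> cball 0 \<rho>)"
    by blast
  ultimately show ?thesis by (rule bounded_subset)
qed

text \<open>\<xi> is the midpoint of the two opposite points, so an upper bound at one of them
  yields a lower bound at the other.\<close>

lemma H_convex_reflect:
  assumes "H_convex \<phi>"
  shows "2 * \<phi> \<xi> - \<phi> (\<xi> \<odot> hexp (- v)) \<le> \<phi> (\<xi> \<odot> hexp v)"
proof -
  have "\<xi> \<odot> hexp (- v) \<odot> hexp ((1/2) *\<^sub>R (2 *\<^sub>R v)) = \<xi>"
    using hmult_hexp_minus[of \<xi> "- v"] by simp
  moreover have "\<xi> \<odot> hexp (- v) \<odot> hexp (2 *\<^sub>R v) = \<xi> \<odot> hexp v"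
    using hmult_hexp_add[of \<xi> "-1" v 2] by simp
  ultimately show ?thesis
    using H_convexD[OF assms, of "1/2" "\<xi> \<odot> hexp (- v)" "2 *\<^sub>R v"] by simp
qed

text \<open>Five horizontal steps of length at most \<rho> lead from \<open>hunit\<close> to any
  point of \<open>A\<close>. Reflection propagates a lower bound from one step to the next, since
  the reflected point lies in the same bounded set, where \<phi> is bounded above.\<close>

lemma H_convex_bdd_below:
  fixes \<phi> :: "'n::finite heis \<Rightarrow> real"
  assumes \<phi>: "H_convex \<phi>" and A: "bounded A"
  shows "\<exists>m. \<forall>\<xi>\<in>A. m \<le> \<phi> \<xi>"
proof -
  have "continuous_on (closure A) gauge_norm"
    unfolding continuous_on_def by (auto intro!: tendsto_eq_intros)
  then have "bounded (gauge_norm ` closure A)"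
    using A by (intro compact_imp_bounded compact_continuous_image) auto
  then obtain \<rho> where \<rho>: "\<And>\<eta>. \<eta> \<in> A \<Longrightarrow> gauge_norm \<eta> \<le> \<rho>"
    using closure_subset[of A] unfolding bounded_iff by fastforce
  define step where "step B = {\<zeta> \<odot> hexp v |\<zeta> v. \<zeta> \<in> B \<and> norm v \<le> \<rho>}" for B :: "'n heis set"
  have "bounded ((step ^^ k) {hunit}) \<and> (\<exists>m. \<forall>\<xi>\<in>(step ^^ k) {hunit}. m \<le> \<phi> \<xi>)" for k
  proof (induction k)
    case (Suc k)
    define B where "B = (step ^^ k) {hunit}"
    obtain m where m: "\<And>\<xi>. \<xi> \<in> B \<Longrightarrow> m \<le> \<phi> \<xi>" using Suc unfolding B_def by blast
    have bd: "bounded (step B)"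
      unfolding step_def using Suc B_def by (intro bounded_horizontal_neighbourhood) blast
    obtain M where M: "\<And>\<xi>. \<xi> \<in> step B \<Longrightarrow> \<phi> \<xi> \<le> M"
      using H_convex_bdd_above[OF \<phi> bd] by blast
    have "2 * m - M \<le> \<phi> (\<zeta> \<odot> hexp v)" if "\<zeta> \<in> B" "norm v \<le> \<rho>" for \<zeta> v
    proof -
      have "\<zeta> \<odot> hexp (- v) \<in> step B"
        unfolding step_def using that by (intro CollectI exI[of _ \<zeta>] exI[of _ "- v"]) auto
      then show ?thesis
        using H_convex_reflect[OF \<phi>, of \<zeta> v] m[OF that(1)] M by fastforce
    qed
    then have "\<forall>\<xi>\<in>step B. 2 * m - M \<le> \<phi> \<xi>" unfolding step_def by blast
    then show ?case using bd unfolding B_def funpow.simps comp_def by blast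
  qed auto
  then obtain m where m: "\<forall>\<xi>\<in>(step ^^ 5) {hunit}. m \<le> \<phi> \<xi>" by blast
  have "\<eta> \<in> (step ^^ 5) {hunit}" if "\<eta> \<in> A" for \<eta>
  proof -
    have st: "\<zeta> \<odot> hexp v \<in> step B" if "\<zeta> \<in> B" "norm v \<le> gauge_norm \<eta>" for \<zeta> v B
      using that \<rho>[OF \<open>\<eta> \<in> A\<close>] order_trans unfolding step_def by blast
    have "hunit \<odot> hexp (hstep1 \<eta>) \<odot> hexp (hstep2 \<eta>) \<odot> hexp (- hstep1 \<eta>) \<odot> hexp (- hstep2 \<eta>) \<odot> hexp (Pr1 \<eta>)
        \<in> step (step (step (step (step {hunit}))))"
      by (intro st) (auto simp: norm_hstep1_le norm_hstep2_le norm_Pr1_le)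
    then show ?thesis by (simp add: hmult_hunit horizontal_decomposition eval_nat_numeral)
  qed
  then show ?thesis using m by blast
qed

section \<open>Continuity\<close>

lemma H_convex_scale:
  assumes "H_convex \<phi>" "0 < s" "s \<le> t"
  shows "(\<phi> (\<xi> \<odot> hexp (s *\<^sub>R v)) - \<phi> \<xi>) / s \<le> (\<phi> (\<xi> \<odot> hexp (t *\<^sub>R v)) - \<phi> \<xi>) / t"
proof -
  have "\<phi> (\<xi> \<odot> hexp ((s / t) *\<^sub>R (t *\<^sub>R v))) \<le> (1 - s / t) * \<phi> \<xi> + (s / t) * \<phi> (\<xi> \<odot> hexp (t *\<^sub>R v))"
    using assms by (intro H_convexD) auto
  then have "\<phi> (\<xi> \<odot> hexp (s *\<^sub>R v)) - \<phi> \<xi> \<le> (s / t) * (\<phi> (\<xi> \<odot> hexp (t *\<^sub>R v)) - \<phi> \<xi>)"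
    using assms by (simp add: algebra_simps)
  then show ?thesis using assms by (simp add: pos_divide_le_eq mult.commute)
qed

text \<open>Monotone difference quotients compare a short step with the unit step in its direction,
  whose increment is controlled by the local bounds. The constant is uniform in the base point near
  \<xi>.\<close>

lemma H_convex_local_Lipschitz:
  fixes \<phi> :: "'n::finite heis \<Rightarrow> real"
  assumes \<phi>: "H_convex \<phi>"
  shows "\<exists>L\<ge>0. \<forall>\<^sub>F x in nhds \<xi> \<times>\<^sub>F nhds 0. \<phi> (fst x \<odot> hexp (snd x)) - \<phi> (fst x) \<le> L * norm (snd x)"
proof -
  define B where "B = {\<zeta> \<odot> hexp v |\<zeta> v. \<zeta> \<in> cball \<xi> 1 \<and> norm v \<le> 1}"
  have "bounded B" unfolding B_def by (intro bounded_horizontal_neighbourhood bounded_cball)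
  then obtain M where M: "\<And>\<zeta>. \<zeta> \<in> B \<Longrightarrow> \<phi> \<zeta> \<le> M" using H_convex_bdd_above[OF \<phi>] by blast
  obtain m where m: "\<And>\<zeta>. \<zeta> \<in> cball \<xi> 1 \<Longrightarrow> m \<le> \<phi> \<zeta>"
    using H_convex_bdd_below[OF \<phi> bounded_cball] by blast
  have est: "\<phi> (\<zeta> \<odot> hexp v) - \<phi> \<zeta> \<le> max 0 (M - m) * norm v" if "dist \<zeta> \<xi> < 1" "norm v < 1" for \<zeta> v
  proof (cases "v = 0")
    case False
    define u where "u = (1 / norm v) *\<^sub>R v"
    have "\<phi> (\<zeta> \<odot> hexp u) \<le> M"
      using that False unfolding B_def
      by (intro M[unfolded B_def] CollectI exI[of _ \<zeta>] exI[of _ u]) (simp add: dist_commute u_def)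
    then have "\<phi> (\<zeta> \<odot> hexp u) - \<phi> \<zeta> \<le> max 0 (M - m)"
      using m[of \<zeta>] that by (simp add: dist_commute)
    moreover have "(\<phi> (\<zeta> \<odot> hexp v) - \<phi> \<zeta>) / norm v \<le> \<phi> (\<zeta> \<odot> hexp u) - \<phi> \<zeta>"
      using H_convex_scale[OF \<phi>, of "norm v" 1 \<zeta> u] that False by (simp add: u_def)
    ultimately have "(\<phi> (\<zeta> \<odot> hexp v) - \<phi> \<zeta>) / norm v \<le> max 0 (M - m)" by linarith
    then show ?thesis using False by (simp add: pos_divide_le_eq)
  qed (simp add: hmult_hunit)
  have "\<forall>\<^sub>F x in nhds \<xi> \<times>\<^sub>F nhds 0. dist (fst x) \<xi> < 1 \<and> norm (snd x :: 'n hlayer) < 1"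
    unfolding eventually_prod_filter eventually_nhds_metric dist_norm
    by (intro exI[of _ "\<lambda>\<zeta>. norm (\<zeta> - \<xi>) < 1"] exI[of _ "\<lambda>v. norm v < 1"]) (auto intro: exI[of _ 1])
  then show ?thesis
    using est by (intro exI[of _ "max 0 (M - m)"]) (auto elim!: eventually_mono)
qed

text \<open>
  The lower bound comes from running through the horizontal decomposition backwards, so that
  one-sided bounds for horizontal steps suffice.
\<close>

lemma horizontal_to_gauge_estimate:
  fixes \<phi> :: "'n::finite heis \<Rightarrow> real"
  assumes E: "\<forall>\<^sub>F x in nhds \<xi> \<times>\<^sub>F nhds 0.
      \<phi> (fst x \<odot> hexp (snd x)) - \<phi> (fst x) \<le> p \<bullet> snd x + \<epsilon> * norm (snd x)"
    and \<epsilon>: "0 \<le> \<epsilon>"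
  shows "\<forall>\<^sub>F \<eta> in nhds hunit. \<bar>\<phi> (\<xi> \<odot> \<eta>) - \<phi> \<xi> - p \<bullet> Pr1 \<eta>\<bar> \<le> 5 * \<epsilon> * gauge_norm \<eta>"
proof -
  define \<zeta>1 where "\<zeta>1 \<eta> = \<xi> \<odot> hexp (hstep1 \<eta>)" for \<eta>
  define \<zeta>2 where "\<zeta>2 \<eta> = \<zeta>1 \<eta> \<odot> hexp (hstep2 \<eta>)" for \<eta>
  define \<zeta>3 where "\<zeta>3 \<eta> = \<zeta>2 \<eta> \<odot> hexp (- hstep1 \<eta>)" for \<eta>
  define \<zeta>4 where "\<zeta>4 \<eta> = \<zeta>3 \<eta> \<odot> hexp (- hstep2 \<eta>)" for \<eta>
  have \<zeta>5: "\<zeta>4 \<eta> \<odot> hexp (Pr1 \<eta>) = \<xi> \<odot> \<eta>" for \<eta>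
    using horizontal_decomposition[of \<eta>]
    by (simp add: \<zeta>1_def \<zeta>2_def \<zeta>3_def \<zeta>4_def hmult_assoc)
  have lim: "(\<zeta>1 \<longlongrightarrow> \<xi>) (nhds hunit)" "(\<zeta>2 \<longlongrightarrow> \<xi>) (nhds hunit)" "(\<zeta>3 \<longlongrightarrow> \<xi>) (nhds hunit)"
      "(\<zeta>4 \<longlongrightarrow> \<xi>) (nhds hunit)" "((\<lambda>\<eta>. \<xi> \<odot> \<eta>) \<longlongrightarrow> \<xi>) (nhds hunit)"
      "(hstep1 \<longlongrightarrow> 0) (nhds hunit)" "(hstep2 \<longlongrightarrow> 0) (nhds hunit)" "(Pr1 \<longlongrightarrow> 0) (nhds hunit)"
    unfolding \<zeta>1_def \<zeta>2_def \<zeta>3_def \<zeta>4_def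
    by (auto intro!: tendsto_eq_intros filterlim_ident simp: hmult_hunit)
  have lim': "((\<lambda>\<eta>. - hstep1 \<eta>) \<longlongrightarrow> 0) (nhds hunit)" "((\<lambda>\<eta>. - hstep2 \<eta>) \<longlongrightarrow> 0) (nhds hunit)"
      "((\<lambda>\<eta>. - Pr1 \<eta>) \<longlongrightarrow> 0) (nhds hunit)"
    using lim(6-8) tendsto_minus by fastforce+
  have ev: "\<forall>\<^sub>F \<eta> in nhds hunit. \<phi> (\<zeta> \<eta> \<odot> hexp (v \<eta>)) - \<phi> (\<zeta> \<eta>) \<le> p \<bullet> v \<eta> + \<epsilon> * gauge_norm \<eta>"
    if "(\<zeta> \<longlongrightarrow> \<xi>) (nhds hunit)" "(v \<longlongrightarrow> 0) (nhds hunit)" "\<And>\<eta>. norm (v \<eta>) \<le> gauge_norm \<eta>"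
    for \<zeta> :: "'n heis \<Rightarrow> 'n heis" and v
    using eventually_compose_filterlim[OF E filterlim_Pair[OF that(1,2)]]
  proof eventually_elim
    case (elim \<eta>)
    then show ?case using mult_left_mono[OF that(3)[of \<eta>] \<epsilon>] by simp
  qed
  have rev: "\<zeta>1 \<eta> \<odot> hexp (- hstep1 \<eta>) = \<xi>" "\<zeta>2 \<eta> \<odot> hexp (- hstep2 \<eta>) = \<zeta>1 \<eta>"
      "\<zeta>3 \<eta> \<odot> hexp (hstep1 \<eta>) = \<zeta>2 \<eta>" "\<zeta>4 \<eta> \<odot> hexp (hstep2 \<eta>) = \<zeta>3 \<eta>" for \<eta>
    using hmult_hexp_minus[of _ "- hstep1 \<eta>"] hmult_hexp_minus[of _ "- hstep2 \<eta>"]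
    by (simp_all add: \<zeta>1_def \<zeta>2_def \<zeta>3_def \<zeta>4_def)
  have rev5: "\<xi> \<odot> \<eta> \<odot> hexp (- Pr1 \<eta>) = \<zeta>4 \<eta>" for \<eta>
    unfolding \<zeta>5[symmetric] by (rule hmult_hexp_minus)
  have nm: "norm (- hstep1 \<eta>) \<le> gauge_norm \<eta>" "norm (- hstep2 \<eta>) \<le> gauge_norm \<eta>"
      "norm (- Pr1 \<eta>) \<le> gauge_norm \<eta>" for \<eta> :: "'n heis"
    by (simp_all add: norm_hstep1_le norm_hstep2_le norm_Pr1_le)
  \<comment> \<open>In the sum of the five estimates the \<open>p\<close> terms of the four
    commutator steps cancel, which leaves \<open>p \<bullet> Pr1 \<eta>\<close> and five error
    terms.\<close>
  note fwd = ev[OF tendsto_const lim(6) norm_hstep1_le, folded \<zeta>1_def]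
    ev[OF lim(1) lim(7) norm_hstep2_le, folded \<zeta>2_def] ev[OF lim(2) lim'(1) nm(1), folded \<zeta>3_def]
    ev[OF lim(3) lim'(2) nm(2), folded \<zeta>4_def] ev[OF lim(4) lim(8) norm_Pr1_le, unfolded \<zeta>5]
  note bwd = ev[OF lim(1) lim'(1) nm(1)] ev[OF lim(2) lim'(2) nm(2)]
    ev[OF lim(3) lim(6) norm_hstep1_le] ev[OF lim(4) lim(7) norm_hstep2_le] ev[OF lim(5) lim'(3) nm(3)]
  show ?thesis
    using fwd bwd[unfolded rev rev5]
  proof eventually_elim
    case (elim \<eta>)
    then show ?case unfolding abs_le_iff inner_minus_right by linarith
  qed
qed

lemma H_convex_isCont:
  fixes \<phi> :: "'n::finite heis \<Rightarrow> real"
  assumes \<phi>: "H_convex \<phi>"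
  shows "isCont \<phi> \<xi>"
proof -
  obtain L where L: "0 \<le> L" "\<forall>\<^sub>F x in nhds \<xi> \<times>\<^sub>F nhds 0.
      \<phi> (fst x \<odot> hexp (snd x)) - \<phi> (fst x) \<le> 0 \<bullet> snd x + L * norm (snd x)"
    using H_convex_local_Lipschitz[OF \<phi>, of \<xi>] by (auto simp del: split_paired_All)
  have lim: "((\<lambda>\<eta>. \<phi> (\<xi> \<odot> \<eta>) - \<phi> \<xi>) \<longlongrightarrow> 0) (nhds hunit)"
  proof (rule Lim_null_comparison)
    show "\<forall>\<^sub>F \<eta> in nhds hunit. norm (\<phi> (\<xi> \<odot> \<eta>) - \<phi> \<xi>) \<le> 5 * L * gauge_norm \<eta>"
      using horizontal_to_gauge_estimate[OF L(2,1)] by simp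
    have "((\<lambda>\<eta>::'n heis. 5 * L * gauge_norm \<eta>) \<longlongrightarrow> 5 * L * gauge_norm (hunit :: 'n heis)) (nhds hunit)"
      by (intro tendsto_mult_left tendsto_gauge_norm filterlim_ident)
    then show "((\<lambda>\<eta>::'n heis. 5 * L * gauge_norm \<eta>) \<longlongrightarrow> 0) (nhds hunit)"
      by (simp add: hunit_def)
  qed
  \<comment> \<open>Left translation carries the limit at \<open>hunit\<close> to \<xi>.\<close>
  have "((\<lambda>\<zeta>. hinv \<xi> \<odot> \<zeta>) \<longlongrightarrow> hinv \<xi> \<odot> \<xi>) (at \<xi>)"
    by (intro tendsto_hmult tendsto_const tendsto_ident_at)
  then have "((\<lambda>\<zeta>. \<phi> (\<xi> \<odot> (hinv \<xi> \<odot> \<zeta>)) - \<phi> \<xi>) \<longlongrightarrow> 0) (at \<xi>)"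
    unfolding hmult_hinv by (rule filterlim_compose[OF lim])
  then show ?thesis by (simp add: isCont_def LIM_zero_iff)
qed

section \<open>Directional derivatives and the H-subdifferential\<close>

text \<open>For H-convex \<phi> the quotients increase with \<open>t\<close>, so this infimum is the
  one-sided derivative at 0.\<close>

definition H_dirderiv :: "('n::finite heis \<Rightarrow> real) \<Rightarrow> 'n heis \<Rightarrow> 'n hlayer \<Rightarrow> real" where
  "H_dirderiv \<phi> \<xi> v = (INF t\<in>{0<..}. (\<phi> (\<xi> \<odot> hexp (t *\<^sub>R v)) - \<phi> \<xi>) / t)"

text \<open>Reflection bounds a quotient below by minus the quotient in direction
  \<open>- v\<close>. Passing first to \<open>s \<le> 1\<close> makes the unit step along
  \<open>- v\<close> serve for all \<open>t\<close>.\<close>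

lemma H_dirderiv_bdd_below:
  assumes \<phi>: "H_convex \<phi>"
  shows "bdd_below ((\<lambda>t. (\<phi> (\<xi> \<odot> hexp (t *\<^sub>R v)) - \<phi> \<xi>) / t) ` {0<..})"
proof (rule bdd_belowI2)
  fix t :: real assume "t \<in> {0<..}"
  then have t: "0 < t" by simp
  define s where "s = min t 1"
  have s: "0 < s" "s \<le> t" "s \<le> 1" using t by (auto simp: s_def)
  have "(\<phi> (\<xi> \<odot> hexp (s *\<^sub>R (- v))) - \<phi> \<xi>) / s \<le> \<phi> (\<xi> \<odot> hexp (- v)) - \<phi> \<xi>"
    using H_convex_scale[OF \<phi> s(1,3), of \<xi> "- v"] by simp
  moreover have "- ((\<phi> (\<xi> \<odot> hexp (s *\<^sub>R (- v))) - \<phi> \<xi>) / s) \<le> (\<phi> (\<xi> \<odot> hexp (s *\<^sub>R v)) - \<phi> \<xi>) / s"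
  proof -
    have "- (\<phi> (\<xi> \<odot> hexp (s *\<^sub>R (- v))) - \<phi> \<xi>) \<le> \<phi> (\<xi> \<odot> hexp (s *\<^sub>R v)) - \<phi> \<xi>"
      using H_convex_reflect[OF \<phi>, of \<xi> "s *\<^sub>R v"] by simp
    then show ?thesis
      using s(1) by (metis divide_right_mono less_imp_le minus_divide_left)
  qed
  moreover have "(\<phi> (\<xi> \<odot> hexp (s *\<^sub>R v)) - \<phi> \<xi>) / s \<le> (\<phi> (\<xi> \<odot> hexp (t *\<^sub>R v)) - \<phi> \<xi>) / t"
    using H_convex_scale[OF \<phi> s(1,2)] .
  ultimately show "\<phi> \<xi> - \<phi> (\<xi> \<odot> hexp (- v)) \<le> (\<phi> (\<xi> \<odot> hexp (t *\<^sub>R v)) - \<phi> \<xi>) / t"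
    by linarith
qed

lemma H_dirderiv_le:
  assumes "H_convex \<phi>" "0 < t"
  shows "t * H_dirderiv \<phi> \<xi> v \<le> \<phi> (\<xi> \<odot> hexp (t *\<^sub>R v)) - \<phi> \<xi>"
proof -
  have "H_dirderiv \<phi> \<xi> v \<le> (\<phi> (\<xi> \<odot> hexp (t *\<^sub>R v)) - \<phi> \<xi>) / t"
    unfolding H_dirderiv_def using assms by (intro cINF_lower H_dirderiv_bdd_below) auto
  then show ?thesis using assms by (simp add: pos_le_divide_eq mult.commute)
qed

lemma H_dirderiv_greatest:
  assumes "\<And>t. 0 < t \<Longrightarrow> t * a \<le> \<phi> (\<xi> \<odot> hexp (t *\<^sub>R v)) - \<phi> \<xi>"
  shows "a \<le> H_dirderiv \<phi> \<xi> v"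
  unfolding H_dirderiv_def using assms
  by (intro cINF_greatest) (auto simp: pos_le_divide_eq mult.commute)

lemma H_dirderiv_less:
  assumes \<phi>: "H_convex \<phi>" and q: "H_dirderiv \<phi> \<xi> v < q"
  obtains h where "0 < h" "\<And>s. 0 < s \<Longrightarrow> s \<le> h \<Longrightarrow> \<phi> (\<xi> \<odot> hexp (s *\<^sub>R v)) - \<phi> \<xi> < s * q"
proof -
  obtain h where h: "0 < h" "(\<phi> (\<xi> \<odot> hexp (h *\<^sub>R v)) - \<phi> \<xi>) / h < q"
    using q unfolding H_dirderiv_def by (subst (asm) cINF_less_iff) (auto simp: H_dirderiv_bdd_below[OF \<phi>])
  have "\<phi> (\<xi> \<odot> hexp (s *\<^sub>R v)) - \<phi> \<xi> < s * q" if "0 < s" "s \<le> h" for s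
  proof -
    have "(\<phi> (\<xi> \<odot> hexp (s *\<^sub>R v)) - \<phi> \<xi>) / s < q"
      using H_convex_scale[OF \<phi> that, of \<xi> v] h(2) by linarith
    then show ?thesis using that by (simp add: pos_divide_less_eq mult.commute)
  qed
  then show ?thesis using that h by blast
qed

lemma H_dirderiv_scale:
  assumes \<phi>: "H_convex \<phi>" and c: "0 < c"
  shows "H_dirderiv \<phi> \<xi> (c *\<^sub>R v) = c * H_dirderiv \<phi> \<xi> v"
proof (rule antisym)
  have le: "c * H_dirderiv \<phi> \<xi> v \<le> H_dirderiv \<phi> \<xi> (c *\<^sub>R v)" if "0 < c" for c v
    using H_dirderiv_le[OF \<phi>, of "t * c" \<xi> v for t] that
    by (intro H_dirderiv_greatest) (auto simp: mult.assoc)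
  then show "c * H_dirderiv \<phi> \<xi> v \<le> H_dirderiv \<phi> \<xi> (c *\<^sub>R v)" using c .
  have "(1 / c) * H_dirderiv \<phi> \<xi> (c *\<^sub>R v) \<le> H_dirderiv \<phi> \<xi> v"
    using le[of "1 / c" "c *\<^sub>R v"] c by simp
  then show "H_dirderiv \<phi> \<xi> (c *\<^sub>R v) \<le> c * H_dirderiv \<phi> \<xi> v"
    using c by (simp add: pos_divide_le_eq mult.commute)
qed

text \<open>The hypothesis is strict and concerns the single length \<open>h\<close>, so by
  continuity it survives a small change of the base point; monotone quotients then cover all shorter
  lengths at once.\<close>

lemma H_convex_step_le:
  assumes \<phi>: "H_convex \<phi>" and h: "\<phi> (\<zeta> \<odot> hexp (h *\<^sub>R v)) - \<phi> \<zeta> < h * q"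
    and s: "0 < s" "s \<le> h"
  shows "\<phi> (\<zeta> \<odot> hexp (s *\<^sub>R v)) - \<phi> \<zeta> \<le> s * q"
proof -
  have "(\<phi> (\<zeta> \<odot> hexp (h *\<^sub>R v)) - \<phi> \<zeta>) / h \<le> q"
    using h s by (simp add: pos_divide_le_eq mult.commute)
  then have "(\<phi> (\<zeta> \<odot> hexp (s *\<^sub>R v)) - \<phi> \<zeta>) / s \<le> q"
    using H_convex_scale[OF \<phi> s, of \<zeta> v] by linarith
  then show ?thesis using s by (simp add: pos_divide_le_eq mult.commute)
qed

lemma tendsto_H_convex:
  fixes \<phi> :: "'n::finite heis \<Rightarrow> real"
  assumes "H_convex \<phi>" "(f \<longlongrightarrow> a) F"
  shows "((\<lambda>x. \<phi> (f x)) \<longlongrightarrow> \<phi> a) F"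
  using isCont_tendsto_compose[OF H_convex_isCont[OF assms(1)] assms(2)] .

text \<open>
  The zigzag path made of \<open>k\<close> steps \<open>hexp ((t / k) v)\<close> alternating with \<open>k\<close> steps \<open>hexp ((t / k) w)\<close>
  ends at \<open>hexp (t (v + w))\<close> up to a vertical error of order \<open>1 / k\<close>.
\<close>

lemma H_dirderiv_add_le:
  fixes \<phi> :: "'n::finite heis \<Rightarrow> real"
  assumes \<phi>: "H_convex \<phi>"
  shows "H_dirderiv \<phi> \<xi> (v + w) \<le> H_dirderiv \<phi> \<xi> v + H_dirderiv \<phi> \<xi> w"
proof (rule field_le_epsilon)
  fix e :: real assume e: "0 < e"
  define q1 q2 where "q1 = H_dirderiv \<phi> \<xi> v + e / 2" and "q2 = H_dirderiv \<phi> \<xi> w + e / 2"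
  have "H_dirderiv \<phi> \<xi> v < q1" "H_dirderiv \<phi> \<xi> w < q2" using e by (simp_all add: q1_def q2_def)
  then obtain h1 h2 where h1: "0 < h1" "\<And>s. 0 < s \<Longrightarrow> s \<le> h1 \<Longrightarrow> \<phi> (\<xi> \<odot> hexp (s *\<^sub>R v)) - \<phi> \<xi> < s * q1"
    and h2: "0 < h2" "\<And>s. 0 < s \<Longrightarrow> s \<le> h2 \<Longrightarrow> \<phi> (\<xi> \<odot> hexp (s *\<^sub>R w)) - \<phi> \<xi> < s * q2"
    using H_dirderiv_less[OF \<phi>] by metis
  define h where "h = min h1 h2"
  have h: "0 < h" using h1 h2 by (simp add: h_def)
  have step: "\<forall>\<^sub>F \<zeta> in nhds \<xi>. \<forall>s. 0 < s \<longrightarrow> s \<le> h \<longrightarrow> \<phi> (\<zeta> \<odot> hexp (s *\<^sub>R u)) - \<phi> \<zeta> \<le> s * q"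
    if "\<phi> (\<xi> \<odot> hexp (h *\<^sub>R u)) - \<phi> \<xi> < h * q" for u q
  proof -
    have "((\<lambda>\<zeta>. \<phi> (\<zeta> \<odot> hexp (h *\<^sub>R u)) - \<phi> \<zeta>) \<longlongrightarrow> \<phi> (\<xi> \<odot> hexp (h *\<^sub>R u)) - \<phi> \<xi>) (nhds \<xi>)"
      by (intro tendsto_diff tendsto_H_convex[OF \<phi>] tendsto_hmult tendsto_const filterlim_ident)
    from order_tendstoD(2)[OF this that] show ?thesis
      by eventually_elim (use H_convex_step_le[OF \<phi>] in blast)
  qed
  \<comment> \<open>One pair of steps of size \<open>s\<close> gains the height
    \<open>s\<^sup>2 * c\<close>. All pairs have the same horizontal displacement, so these heights
    simply add up.\<close>
  define c where "c = 2 * (fst w \<bullet> snd v - fst v \<bullet> snd w)"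
  define Z where "Z z m = \<xi> \<odot> (z *\<^sub>R fst (v + w), z *\<^sub>R snd (v + w), m * c)" for z m :: real
  have Z_step: "Z (real j * s) (real j * s\<^sup>2) \<odot> hexp (s *\<^sub>R v) \<odot> hexp (s *\<^sub>R w)
      = Z (real (Suc j) * s) (real (Suc j) * s\<^sup>2)" for j s
    by (simp add: Z_def c_def hmult_assoc hexp_alt) (simp add: algebra_simps inner_commute power2_eq_square)
  \<comment> \<open>Both kinds of corner of the zigzag are values of \<open>f\<close>: the third
    coordinate is 0 before the step along \<open>v\<close> and \<open>s\<close> before the step
    along \<open>w\<close>.\<close>
  define f where "f x = Z (fst x) (fst (snd x)) \<odot> hexp (snd (snd x) *\<^sub>R v)" for x :: "real \<times> real \<times> real"
  have "(f \<longlongrightarrow> \<xi>) (nhds 0)"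
    unfolding f_def Z_def by (auto intro!: tendsto_eq_intros filterlim_ident simp: hmult_hunit hmult_hunit[unfolded hunit_def])
  from eventually_compose_filterlim[OF eventually_conj[OF step[of v q1] step[of w q2]] this]
  have "\<forall>\<^sub>F x in nhds 0. \<forall>s. 0 < s \<longrightarrow> s \<le> h \<longrightarrow>
      \<phi> (f x \<odot> hexp (s *\<^sub>R v)) - \<phi> (f x) \<le> s * q1 \<and> \<phi> (f x \<odot> hexp (s *\<^sub>R w)) - \<phi> (f x) \<le> s * q2"
    using h1(2)[of h] h2(2)[of h] h by (auto simp: h_def elim: eventually_mono)
  then obtain \<delta> where \<delta>: "0 < \<delta>" "\<And>x s. norm x < \<delta> \<Longrightarrow> 0 < s \<Longrightarrow> s \<le> h \<Longrightarrow>
      \<phi> (f x \<odot> hexp (s *\<^sub>R v)) - \<phi> (f x) \<le> s * q1 \<and> \<phi> (f x \<odot> hexp (s *\<^sub>R w)) - \<phi> (f x) \<le> s * q2"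
    unfolding eventually_nhds_metric by (auto simp del: split_paired_All)
  \<comment> \<open>The bound \<open>t \<le> 1\<close> keeps \<open>real j * s\<^sup>2\<close> below
    \<open>t\<close>; the arguments of \<open>f\<close> then have norm at most \<open>3 * t\<close>,
    which is less than \<delta>.\<close>
  define t where "t = min h (min 1 (\<delta> / 4))"
  have t: "0 < t" "t \<le> h" "t \<le> 1" "4 * t \<le> \<delta>" using h \<delta>(1) by (auto simp: t_def)
  have zig: "\<phi> (Z (real j * s) (real j * s\<^sup>2)) - \<phi> \<xi> \<le> real j * s * (q1 + q2)"
    if "0 < s" "real j * s \<le> t" "s \<le> t" for j s
    using that
  proof (induction j)
    case 0
    then show ?case by (simp add: Z_def hmult_hunit flip: hunit_def)
  next
    case (Suc j)
    have js: "0 \<le> real j * s" "real j * s \<le> t" using Suc.prems by (simp_all add: algebra_simps)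
    have "real j * s * s \<le> t * 1"
      using js Suc.prems t by (intro mult_mono) auto
    then have js2: "\<bar>real j * s\<^sup>2\<bar> \<le> t" using Suc.prems by (simp add: power2_eq_square mult.assoc)
    have n: "norm (real j * s, real j * s\<^sup>2, x) < \<delta>" if "\<bar>x\<bar> \<le> t" for x
    proof -
      have "norm (real j * s, real j * s\<^sup>2, x) \<le> t + (t + t)"
        using norm_Pair_le[of "real j * s" "(real j * s\<^sup>2, x)"] norm_Pair_le[of "real j * s\<^sup>2" x]
          js js2 that by simp
      then show ?thesis using t by linarith
    qed
    have "\<phi> (Z (real j * s) (real j * s\<^sup>2) \<odot> hexp (s *\<^sub>R v)) - \<phi> (Z (real j * s) (real j * s\<^sup>2)) \<le> s * q1"
      using \<delta>(2)[OF n[of 0], of s] t Suc.prems by (simp add: f_def hmult_hunit)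
    moreover have "\<phi> (Z (real (Suc j) * s) (real (Suc j) * s\<^sup>2))
        - \<phi> (Z (real j * s) (real j * s\<^sup>2) \<odot> hexp (s *\<^sub>R v)) \<le> s * q2"
      using \<delta>(2)[OF n[of s], of s] t Suc.prems Z_step[of j s] by (simp add: f_def)
    moreover have "\<phi> (Z (real j * s) (real j * s\<^sup>2)) - \<phi> \<xi> \<le> real j * s * (q1 + q2)"
      using Suc.IH Suc.prems js by simp
    ultimately show ?case by (simp add: algebra_simps)
  qed
  \<comment> \<open>With \<open>Suc k\<close> pairs of size \<open>t / real (Suc k)\<close> the path
    reaches parameter \<open>t\<close>, and its height coefficient is
    \<open>t * (t / real (Suc k))\<close>.\<close>
  have bound: "\<phi> (Z t (t * (t / real (Suc k)))) - \<phi> \<xi> \<le> t * (q1 + q2)" for k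
  proof -
    have "t / real (Suc k) \<le> t" using t by (simp add: divide_le_eq algebra_simps)
    then show ?thesis
      using zig[of "t / real (Suc k)" "Suc k"] t by (simp add: power2_eq_square del: of_nat_Suc)
  qed
  have "(\<lambda>k. t / real (Suc k)) \<longlonglongrightarrow> 0"
    by (rule LIMSEQ_Suc[OF lim_const_over_n])
  then have "(\<lambda>k. \<phi> (Z t (t * (t / real (Suc k)))) - \<phi> \<xi>) \<longlonglongrightarrow> \<phi> (Z t (t * 0)) - \<phi> \<xi>"
    unfolding Z_def by (intro tendsto_intros tendsto_H_convex[OF \<phi>])
  then have "\<phi> (Z t (t * 0)) - \<phi> \<xi> \<le> t * (q1 + q2)"
    using bound by (intro LIMSEQ_le_const2) auto
  then have "\<phi> (\<xi> \<odot> hexp (t *\<^sub>R (v + w))) - \<phi> \<xi> \<le> t * (q1 + q2)"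
    by (simp add: Z_def hexp_alt)
  then have "t * H_dirderiv \<phi> \<xi> (v + w) \<le> t * (q1 + q2)"
    using H_dirderiv_le[OF \<phi> t(1), of \<xi> "v + w"] by linarith
  then show "H_dirderiv \<phi> \<xi> (v + w) \<le> H_dirderiv \<phi> \<xi> v + H_dirderiv \<phi> \<xi> w + e"
    using t by (simp add: q1_def q2_def)
qed

section \<open>Supporting functionals and existence of H-subgradients\<close>

text \<open>Hahn--Banach in finite dimension: a hyperplane separates \<open>(v0, D v0)\<close> from
  the strict epigraph of \<open>D\<close>.\<close>

lemma sublinear_support:
  fixes D :: "'a::euclidean_space \<Rightarrow> real"
  assumes scale: "\<And>c v. 0 < c \<Longrightarrow> D (c *\<^sub>R v) = c * D v"
    and add: "\<And>v w. D (v + w) \<le> D v + D w"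
  obtains p where "\<And>v. p \<bullet> v \<le> D v" "p \<bullet> v0 = D v0"
proof -
  have D0: "D 0 = 0" using scale[of 2 0] by simp
  define T where "T = {x :: 'a \<times> real. D (fst x) < snd x}"
  have "convex T"
    unfolding convex_alt
  proof (intro ballI allI impI)
    fix x y :: "'a \<times> real" and u :: real assume xy: "x \<in> T" "y \<in> T" and u: "0 \<le> u \<and> u \<le> 1"
    show "(1 - u) *\<^sub>R x + u *\<^sub>R y \<in> T"
    proof (cases "u = 0 \<or> u = 1")
      case False
      then have u: "0 < u" "u < 1" using u by auto
      have "D ((1 - u) *\<^sub>R fst x + u *\<^sub>R fst y) \<le> (1 - u) * D (fst x) + u * D (fst y)"
        using add[of "(1 - u) *\<^sub>R fst x" "u *\<^sub>R fst y"] scale u by simp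
      also have "\<dots> < (1 - u) * snd x + u * snd y"
        using xy u by (intro add_strict_mono mult_strict_left_mono) (auto simp: T_def)
      finally show ?thesis by (simp add: T_def)
    qed (use xy in auto)
  qed
  moreover have "{(v0, D v0)} \<inter> T = {}" "T \<noteq> {}"
  proof -
    have "(0, 1) \<in> T" by (simp add: T_def D0)
    then show "T \<noteq> {}" by blast
  qed (simp add: T_def)
  ultimately obtain a b where a: "a \<noteq> 0" "a \<bullet> (v0, D v0) \<le> b" "\<And>x. x \<in> T \<Longrightarrow> b \<le> a \<bullet> x"
    using separating_hyperplane_sets[OF convex_singleton, of T "(v0, D v0)"] by blast
  obtain \<alpha> \<beta> where ab: "a = (\<alpha>, \<beta>)" by (cases a)
  have sep: "\<alpha> \<bullet> v0 + \<beta> * D v0 \<le> \<alpha> \<bullet> v + \<beta> * t" if "D v < t" for v t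
    using a(2) a(3)[of "(v, t)"] that by (simp add: ab T_def)
  have "0 \<le> \<beta>"
    using sep[of v0 "D v0 + 1"] by (simp add: algebra_simps)
  \<comment> \<open>The hyperplane cannot be vertical, since the epigraph has points over every
    \<open>v\<close>.\<close>
  moreover have "\<beta> \<noteq> 0"
  proof
    assume "\<beta> = 0"
    then have "\<alpha> \<bullet> v0 \<le> \<alpha> \<bullet> (v0 - \<alpha>)" using sep[of "v0 - \<alpha>" "D (v0 - \<alpha>) + 1"] by simp
    then have "\<alpha> = 0" by (simp add: inner_diff_right) (metis inner_ge_zero inner_eq_zero_iff order_antisym)
    then show False using a(1) \<open>\<beta> = 0\<close> ab by (simp add: zero_prod_def)
  qed
  ultimately have \<beta>: "0 < \<beta>" by simp
  define p where "p = - (1 / \<beta>) *\<^sub>R \<alpha>"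
  have "D v0 - p \<bullet> v0 \<le> t - p \<bullet> v" if "D v < t" for v t
    using divide_right_mono[OF sep[OF that], of \<beta>] \<beta> by (simp add: p_def add_divide_distrib)
  note below = this
  have sup: "D v0 - p \<bullet> v0 \<le> D v - p \<bullet> v" for v
  proof (rule field_le_epsilon)
    fix e :: real assume "0 < e"
    then show "D v0 - p \<bullet> v0 \<le> D v - p \<bullet> v + e" using below[of v "D v + e"] by simp
  qed
  \<comment> \<open>By homogeneity, testing at 0 and at \<open>2 *\<^sub>R v0\<close> gives the two
    inequalities.\<close>
  have eq: "p \<bullet> v0 = D v0"
    using sup[of 0] sup[of "2 *\<^sub>R v0"] scale[of 2 v0] D0 by simp
  have "p \<bullet> v \<le> D v" for v using sup[of v] eq by simp
  then show ?thesis using that eq by blast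
qed

lemma H_subdiff_iff: "p \<in> H_subdiff \<phi> \<xi> \<longleftrightarrow> (\<forall>v. \<phi> \<xi> + p \<bullet> v \<le> \<phi> (\<xi> \<odot> hexp v))"
  by (simp add: H_subdiff_def hplane_eq_range_hexp)

text \<open>Rescaling the subgradient inequality along \<open>t *\<^sub>R v\<close> gives one
  direction, \<open>t = 1\<close> the other. Subgradients thus become linear minorants of a
  sublinear function.\<close>

lemma H_subdiff_iff_dirderiv:
  assumes \<phi>: "H_convex \<phi>"
  shows "p \<in> H_subdiff \<phi> \<xi> \<longleftrightarrow> (\<forall>v. p \<bullet> v \<le> H_dirderiv \<phi> \<xi> v)"
proof
  assume p: "p \<in> H_subdiff \<phi> \<xi>"
  show "\<forall>v. p \<bullet> v \<le> H_dirderiv \<phi> \<xi> v"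
  proof
    fix v show "p \<bullet> v \<le> H_dirderiv \<phi> \<xi> v"
    proof (rule H_dirderiv_greatest)
      fix t :: real
      show "t * (p \<bullet> v) \<le> \<phi> (\<xi> \<odot> hexp (t *\<^sub>R v)) - \<phi> \<xi>"
        using p[unfolded H_subdiff_iff, rule_format, of "t *\<^sub>R v"] by simp
    qed
  qed
next
  assume p: "\<forall>v. p \<bullet> v \<le> H_dirderiv \<phi> \<xi> v"
  show "p \<in> H_subdiff \<phi> \<xi>"
    unfolding H_subdiff_iff
  proof
    fix v show "\<phi> \<xi> + p \<bullet> v \<le> \<phi> (\<xi> \<odot> hexp v)"
      using H_dirderiv_le[OF \<phi>, of 1 \<xi> v] p[rule_format, of v] by simp
  qed
qed

text \<open>Provides nonemptiness of the H-subdifferential and, beyond that, exactness in a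
  prescribed direction, on which the exclusion of kinks rests.\<close>

lemma H_subdiff_attains_dirderiv:
  fixes \<phi> :: "'n::finite heis \<Rightarrow> real"
  assumes \<phi>: "H_convex \<phi>"
  obtains p where "p \<in> H_subdiff \<phi> \<xi>" "p \<bullet> v = H_dirderiv \<phi> \<xi> v"
proof -
  obtain p where "\<And>w. p \<bullet> w \<le> H_dirderiv \<phi> \<xi> w" "p \<bullet> v = H_dirderiv \<phi> \<xi> v"
    using sublinear_support[of "H_dirderiv \<phi> \<xi>" v] H_dirderiv_scale[OF \<phi>] H_dirderiv_add_le[OF \<phi>]
    by metis
  then show ?thesis using that H_subdiff_iff_dirderiv[OF \<phi>] by blast
qed

section \<open>H-differentiability\<close>

lemma has_H_gradient_along:
  fixes \<phi> :: "'n::finite heis \<Rightarrow> real"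
  assumes "has_H_gradient \<phi> p \<xi>"
  shows "((\<lambda>t. (\<phi> (\<xi> \<odot> hexp (t *\<^sub>R v)) - \<phi> \<xi>) / t) \<longlongrightarrow> p \<bullet> v) (at_right 0)"
proof (cases "v = 0")
  case False
  have "((\<lambda>t. hexp (t *\<^sub>R v)) \<longlongrightarrow> hexp (0 *\<^sub>R v)) (at_right 0)"
    by (intro tendsto_intros)
  moreover have "\<forall>\<^sub>F t in at_right 0. hexp (t *\<^sub>R v) \<noteq> hunit"
    using False by (auto simp: eventually_at_filter hexp_alt hunit_def prod_eq_iff)
  ultimately have "filterlim (\<lambda>t. hexp (t *\<^sub>R v)) (at hunit) (at_right 0)"
    by (simp add: filterlim_at eventually_mono)
  from landau_o.small.compose[OF assms[unfolded has_H_gradient_def] this]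
  have "(\<lambda>t. \<phi> (\<xi> \<odot> hexp (t *\<^sub>R v)) - \<phi> \<xi> - t * (p \<bullet> v)) \<in> o[at_right 0](\<lambda>t. t)"
    using False by (simp add: gauge_norm_hexp)
  then have "((\<lambda>t. (\<phi> (\<xi> \<odot> hexp (t *\<^sub>R v)) - \<phi> \<xi> - t * (p \<bullet> v)) / t) \<longlongrightarrow> 0) (at_right 0)"
    by (rule smalloD_tendsto)
  then have "((\<lambda>t. (\<phi> (\<xi> \<odot> hexp (t *\<^sub>R v)) - \<phi> \<xi>) / t - p \<bullet> v) \<longlongrightarrow> 0) (at_right 0)"
    by (rule Lim_transform_eventually)
      (auto simp: eventually_at_filter diff_divide_distrib)
  then show ?thesis by (simp add: LIM_zero_iff)
qed (simp add: hmult_hunit)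

text \<open>The gradient prescribes the limit of the quotients at 0 from the right, and by
  monotonicity this limit is their infimum.\<close>

lemma has_H_gradient_dirderiv:
  fixes \<phi> :: "'n::finite heis \<Rightarrow> real"
  assumes \<phi>: "H_convex \<phi>" and p: "has_H_gradient \<phi> p \<xi>"
  shows "H_dirderiv \<phi> \<xi> v = p \<bullet> v"
proof (rule antisym)
  have ev: "\<forall>\<^sub>F t in at_right 0. (0::real) < t" by (simp add: eventually_at_filter)
  show "H_dirderiv \<phi> \<xi> v \<le> p \<bullet> v"
  proof (rule tendsto_lowerbound[OF has_H_gradient_along[OF p]])
    show "\<forall>\<^sub>F t in at_right 0. H_dirderiv \<phi> \<xi> v \<le> (\<phi> (\<xi> \<odot> hexp (t *\<^sub>R v)) - \<phi> \<xi>) / t"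
      using ev by eventually_elim (use H_dirderiv_le[OF \<phi>] in \<open>simp add: pos_le_divide_eq mult.commute\<close>)
  qed simp
  show "p \<bullet> v \<le> H_dirderiv \<phi> \<xi> v"
  proof (rule H_dirderiv_greatest)
    fix s :: real assume s: "0 < s"
    have "p \<bullet> v \<le> (\<phi> (\<xi> \<odot> hexp (s *\<^sub>R v)) - \<phi> \<xi>) / s"
    proof (rule tendsto_upperbound[OF has_H_gradient_along[OF p]])
      have "\<forall>\<^sub>F t in at_right 0. t < s" using s eventually_at_right_less eventually_at_right by blast
      with ev show "\<forall>\<^sub>F t in at_right 0. (\<phi> (\<xi> \<odot> hexp (t *\<^sub>R v)) - \<phi> \<xi>) / t
          \<le> (\<phi> (\<xi> \<odot> hexp (s *\<^sub>R v)) - \<phi> \<xi>) / s"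
        by eventually_elim (use H_convex_scale[OF \<phi>] in auto)
    qed simp
    then show "s * (p \<bullet> v) \<le> \<phi> (\<xi> \<odot> hexp (s *\<^sub>R v)) - \<phi> \<xi>"
      using s by (simp add: pos_le_divide_eq mult.commute)
  qed
qed

text \<open>A linear functional dominated by another one equals it. This identifies the slope
  \<open>p\<close> of a section with the gradient used in \<open>m_H\<close> and
  \<open>M_H\<close>.\<close>

lemma H_subdiff_eq_gradient:
  fixes \<phi> :: "'n::finite heis \<Rightarrow> real"
  assumes \<phi>: "H_convex \<phi>" and p: "has_H_gradient \<phi> p \<xi>"
  shows "H_subdiff \<phi> \<xi> = {p}"
proof -
  have "q = p" if "\<And>v. q \<bullet> v \<le> p \<bullet> v" for q
  proof -
    have "(q - p) \<bullet> (q - p) \<le> 0" using that[of "q - p"] by (simp add: inner_diff_left)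
    then show ?thesis by (metis antisym inner_ge_zero inner_eq_zero_iff right_minus_eq)
  qed
  then show ?thesis
    unfolding set_eq_iff singleton_iff H_subdiff_iff_dirderiv[OF \<phi>] has_H_gradient_dirderiv[OF \<phi> p] by blast
qed

lemma H_gradient_eqI: "has_H_gradient \<phi> p \<xi> \<Longrightarrow> H_gradient \<phi> \<xi> = p"
  unfolding H_gradient_def by (blast intro: has_H_gradient_unique)

text \<open>
  A failing sequence of steps has, after normalisation, a limiting direction, in which the
  directional derivative would exceed the linear bound.
\<close>

lemma has_H_gradientI:
  fixes \<phi> :: "'n::finite heis \<Rightarrow> real"
  assumes \<phi>: "H_convex \<phi>" and p: "\<And>v. H_dirderiv \<phi> \<xi> v \<le> p \<bullet> v"
  shows "has_H_gradient \<phi> p \<xi>"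
proof -
  \<comment> \<open>A one-sided bound uniform in base points near \<xi>, as
    \<open>horizontal_to_gauge_estimate\<close> requires.\<close>
  have E: "\<forall>\<^sub>F x in nhds \<xi> \<times>\<^sub>F nhds 0.
      \<phi> (fst x \<odot> hexp (snd x)) - \<phi> (fst x) \<le> p \<bullet> snd x + \<epsilon> * norm (snd x)" if \<epsilon>: "0 < \<epsilon>" for \<epsilon>
  proof (rule ccontr)
    define P where "P x \<longleftrightarrow> \<phi> (fst x \<odot> hexp (snd x)) - \<phi> (fst x) \<le> p \<bullet> snd x + \<epsilon> * norm (snd x)" for x
    assume "\<not> ?thesis"
    then have "\<not> (\<forall>\<^sub>F x in nhds (\<xi>, 0). P x)" by (simp add: nhds_prod P_def)
    then have "\<forall>k. \<exists>x. dist x (\<xi>, 0) < 1 / real (Suc k) \<and> \<not> P x"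
      unfolding eventually_nhds_metric
      by (metis of_nat_0_less_iff zero_less_Suc zero_less_divide_1_iff)
    then obtain x where x: "\<And>k. dist (x k) (\<xi>, 0) < 1 / real (Suc k)" "\<And>k. \<not> P (x k)" by metis
    have "(\<lambda>k. 1 / real (Suc k)) \<longlonglongrightarrow> 0"
      by (rule LIMSEQ_Suc[OF lim_const_over_n])
    then have "(\<lambda>k. dist (x k) (\<xi>, 0)) \<longlonglongrightarrow> 0"
      by (rule Lim_null_comparison[rotated]) (use x(1) in \<open>auto intro!: always_eventually less_imp_le simp del: of_nat_Suc\<close>)
    then have lim: "x \<longlonglongrightarrow> (\<xi>, 0)" by (rule tendsto_dist_iff[THEN iffD2])
    define \<zeta> v where "\<zeta> k = fst (x k)" and "v k = snd (x k)" for k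
    have lim\<zeta>: "\<zeta> \<longlonglongrightarrow> \<xi>" and limv: "v \<longlonglongrightarrow> 0"
      using tendsto_fst[OF lim] tendsto_snd[OF lim] by (simp_all add: \<zeta>_def[abs_def] v_def[abs_def])
    have fail: "p \<bullet> v k + \<epsilon> * norm (v k) < \<phi> (\<zeta> k \<odot> hexp (v k)) - \<phi> (\<zeta> k)" for k
      using x(2)[of k] by (simp add: P_def \<zeta>_def v_def)
    have v0: "v k \<noteq> 0" for k using fail[of k] by (auto simp: hmult_hunit)
    define u where "u k = (1 / norm (v k)) *\<^sub>R v k" for k
    have "u k \<in> sphere 0 1" for k using v0 by (simp add: u_def)
    then obtain u0 r where r: "strict_mono r" "(u \<circ> r) \<longlonglongrightarrow> u0"
      using compact_sphere[of 0 1, unfolded compact_def] by metis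
    have "H_dirderiv \<phi> \<xi> u0 < p \<bullet> u0 + \<epsilon>" using p[of u0] \<epsilon> by linarith
    then obtain h where h: "0 < h" "\<phi> (\<xi> \<odot> hexp (h *\<^sub>R u0)) - \<phi> \<xi> < h * (p \<bullet> u0 + \<epsilon>)"
      using H_dirderiv_less[OF \<phi>] by (metis order_refl)
    have lr: "(\<zeta> \<circ> r) \<longlonglongrightarrow> \<xi>" "(v \<circ> r) \<longlonglongrightarrow> 0"
      using LIMSEQ_subseq_LIMSEQ[OF lim\<zeta> r(1)] LIMSEQ_subseq_LIMSEQ[OF limv r(1)] .
    have "\<forall>\<^sub>F k in sequentially. norm ((v \<circ> r) k) < h"
      using order_tendstoD(2)[OF tendsto_norm[OF lr(2)]] h by simp
    \<comment> \<open>Monotone quotients move the failure from the vanishing length of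
      \<open>v (r k)\<close> to the fixed length \<open>h\<close>, where continuity permits passing
      to the limit.\<close>
    then have "\<forall>\<^sub>F k in sequentially. h * (p \<bullet> (u \<circ> r) k + \<epsilon>)
        \<le> \<phi> ((\<zeta> \<circ> r) k \<odot> hexp (h *\<^sub>R (u \<circ> r) k)) - \<phi> ((\<zeta> \<circ> r) k)"
    proof eventually_elim
      case (elim k)
      define n where "n = norm (v (r k))"
      have n: "0 < n" "n \<le> h" "v (r k) = n *\<^sub>R u (r k)" using elim v0 by (simp_all add: n_def u_def)
      have "norm (u (r k)) = 1" using v0 by (simp add: u_def)
      then have "n * (p \<bullet> u (r k) + \<epsilon>) \<le> \<phi> (\<zeta> (r k) \<odot> hexp (n *\<^sub>R u (r k))) - \<phi> (\<zeta> (r k))"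
        using fail[of "r k"] n by (simp add: algebra_simps)
      then have "p \<bullet> u (r k) + \<epsilon> \<le> (\<phi> (\<zeta> (r k) \<odot> hexp (n *\<^sub>R u (r k))) - \<phi> (\<zeta> (r k))) / n"
        using n by (simp add: pos_le_divide_eq mult.commute)
      also have "\<dots> \<le> (\<phi> (\<zeta> (r k) \<odot> hexp (h *\<^sub>R u (r k))) - \<phi> (\<zeta> (r k))) / h"
        using H_convex_scale[OF \<phi> n(1,2)] .
      finally show ?case using h by (simp add: pos_le_divide_eq mult.commute)
    qed
    moreover have "(\<lambda>k. h * (p \<bullet> (u \<circ> r) k + \<epsilon>)) \<longlonglongrightarrow> h * (p \<bullet> u0 + \<epsilon>)"
      by (intro tendsto_intros r)
    moreover have "(\<lambda>k. \<phi> ((\<zeta> \<circ> r) k \<odot> hexp (h *\<^sub>R (u \<circ> r) k)) - \<phi> ((\<zeta> \<circ> r) k))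
        \<longlonglongrightarrow> \<phi> (\<xi> \<odot> hexp (h *\<^sub>R u0)) - \<phi> \<xi>"
      by (intro tendsto_diff tendsto_H_convex[OF \<phi>] tendsto_hmult tendsto_hexp tendsto_scaleR tendsto_const r lr)
    ultimately have "h * (p \<bullet> u0 + \<epsilon>) \<le> \<phi> (\<xi> \<odot> hexp (h *\<^sub>R u0)) - \<phi> \<xi>"
      by (intro tendsto_le[OF sequentially_bot])
    then show False using h by simp
  qed
  show ?thesis
    unfolding has_H_gradient_def
  proof (rule landau_o.smallI)
    fix c :: real assume c: "0 < c"
    \<comment> \<open>Dividing \<open>c\<close> by 5 absorbs the errors of the five horizontal
      steps.\<close>
    have "\<forall>\<^sub>F \<eta> in nhds hunit. \<bar>\<phi> (\<xi> \<odot> \<eta>) - \<phi> \<xi> - p \<bullet> Pr1 \<eta>\<bar> \<le> 5 * (c / 5) * gauge_norm \<eta>"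
      using c by (intro horizontal_to_gauge_estimate E) auto
    then show "\<forall>\<^sub>F \<eta> in at hunit. norm (\<phi> (\<xi> \<odot> \<eta>) - \<phi> \<xi> - p \<bullet> Pr1 \<eta>) \<le> c * norm (gauge_norm \<eta>)"
      unfolding eventually_at_filter
      by (rule eventually_mono) (simp add: gauge_norm_nonneg)
  qed
qed

section \<open>Sections and slopes in terms of the excess over the supporting plane\<close>

text \<open>In the coordinate \<open>v\<close>, gauge balls and spheres in the horizontal plane
  become Euclidean ones about 0, and sections become sublevel sets.\<close>

definition H_excess :: "('n::finite heis \<Rightarrow> real) \<Rightarrow> 'n heis \<Rightarrow> 'n hlayer \<Rightarrow> 'n hlayer \<Rightarrow> real" where
  "H_excess \<phi> \<xi> p v = \<phi> (\<xi> \<odot> hexp v) - \<phi> \<xi> - p \<bullet> v"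

lemma H_excess_0 [simp]: "H_excess \<phi> \<xi> p 0 = 0"
  by (simp add: H_excess_def hmult_hunit)

lemma H_excess_nonneg: "p \<in> H_subdiff \<phi> \<xi> \<Longrightarrow> 0 \<le> H_excess \<phi> \<xi> p v"
  unfolding H_subdiff_iff H_excess_def by (metis diff_diff_eq diff_ge_0_iff_ge)

lemma H_excess_scale:
  assumes "H_convex \<phi>" "0 \<le> l" "l \<le> 1"
  shows "H_excess \<phi> \<xi> p (l *\<^sub>R v) \<le> l * H_excess \<phi> \<xi> p v"
  using H_convexD[OF assms, of \<xi> v] by (simp add: H_excess_def algebra_simps)

lemma continuous_on_H_excess:
  assumes "H_convex \<phi>"
  shows "continuous_on A (H_excess \<phi> \<xi> p)"
  unfolding continuous_on_def H_excess_def[abs_def]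
  by (intro ballI tendsto_diff tendsto_H_convex[OF assms] tendsto_hmult tendsto_hexp tendsto_const
      tendsto_inner tendsto_ident_at)

lemma Collect_hplane: "{\<eta> \<in> hplane \<xi>. P \<eta>} = (\<lambda>v. \<xi> \<odot> hexp v) ` {v. P (\<xi> \<odot> hexp v)}"
  unfolding hplane_eq_range_hexp by blast

lemma H_section_eq: "H_section \<phi> \<xi> p s = (\<lambda>v. \<xi> \<odot> hexp v) ` {v. H_excess \<phi> \<xi> p v < s}"
  unfolding H_section_def Collect_hplane H_excess_def by simp

lemma gauge_ball_hplane_eq: "gauge_ball \<xi> R \<inter> hplane \<xi> = (\<lambda>v. \<xi> \<odot> hexp v) ` cball 0 R"
proof -
  have "gauge_ball \<xi> R \<inter> hplane \<xi> = {\<eta> \<in> hplane \<xi>. gauge_dist \<xi> \<eta> \<le> R}"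
    unfolding gauge_ball_def by blast
  then show ?thesis unfolding Collect_hplane by (simp add: cball_def)
qed

lemma hsphere_eq: "hsphere \<xi> r = (\<lambda>v. \<xi> \<odot> hexp v) ` sphere 0 r"
  unfolding hsphere_def Collect_hplane by (simp add: sphere_def)

lemma inj_hmult_hexp: "inj (\<lambda>v. \<xi> \<odot> hexp v)"
  by (rule injI) (metis Pr1_hmult_hexp add_left_imp_eq)

lemma round_H_sections_with_iff:
  "round_H_sections_with K \<phi> \<longleftrightarrow> (\<forall>\<xi>. \<forall>p\<in>H_subdiff \<phi> \<xi>. \<forall>s>0. \<exists>R>0.
    (\<forall>v. norm v \<le> K * R \<longrightarrow> H_excess \<phi> \<xi> p v < s) \<and> (\<forall>v. H_excess \<phi> \<xi> p v < s \<longrightarrow> norm v \<le> R))"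
  unfolding round_H_sections_with_def H_section_eq gauge_ball_hplane_eq
    inj_image_subset_iff[OF inj_hmult_hexp] by (simp add: subset_iff)

lemma m_H_eq: "m_H \<phi> \<xi> r = (INF v\<in>sphere 0 r. H_excess \<phi> \<xi> (H_gradient \<phi> \<xi>) v)"
  unfolding m_H_def hsphere_eq image_image H_excess_def by simp

lemma M_H_eq: "M_H \<phi> \<xi> r = (SUP v\<in>sphere 0 r. H_excess \<phi> \<xi> (H_gradient \<phi> \<xi>) v)"
  unfolding M_H_def hsphere_eq image_image H_excess_def by simp

text \<open>\<open>Pr1\<close> does not increase the norm, and it recovers \<open>v\<close> up to
  translation by \<open>Pr1 \<xi>\<close>.\<close>

lemma bounded_H_section:
  assumes "bounded (H_section \<phi> \<xi> p s)"
  shows "bounded {v. H_excess \<phi> \<xi> p v < s}"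
proof -
  obtain B where B: "\<And>\<eta>. \<eta> \<in> H_section \<phi> \<xi> p s \<Longrightarrow> norm \<eta> \<le> B"
    using assms bounded_iff by blast
  have "norm (Pr1 \<eta>) \<le> norm \<eta>" for \<eta> :: "'a heis"
    by (cases \<eta>) (simp add: norm_Pair)
  then have "norm v \<le> B + norm (Pr1 \<xi>)" if "H_excess \<phi> \<xi> p v < s" for v
  proof -
    have "norm (\<xi> \<odot> hexp v) \<le> B" using that by (intro B) (simp add: H_section_eq)
    then have "norm (Pr1 \<xi> + v) \<le> B"
      using \<open>\<And>\<eta>. norm (Pr1 \<eta>) \<le> norm \<eta>\<close>[of "\<xi> \<odot> hexp v"] by simp
    then show ?thesis
      using norm_triangle_ineq4[of "Pr1 \<xi> + v" "Pr1 \<xi>"] by simp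
  qed
  then show ?thesis unfolding bounded_iff by blast
qed

section \<open>Controlled slope implies round sections\<close>

text \<open>A farthest point \<open>v0\<close> of the closure of the section has excess at most
  \<open>s\<close>, so on the sphere of radius \<open>R\<close> the minimum is at most
  \<open>s\<close> and the maximum at most \<open>K * s\<close>. Shrinking by
  \<open>1 / (K + 1)\<close> brings this below \<open>s\<close>.\<close>

lemma controlled_imp_round:
  fixes \<phi> :: "'n::finite heis \<Rightarrow> real"
  assumes \<phi>: "H_convex \<phi>" and bd: "bounded_H_sections \<phi>"
    and slope: "controlled_H_slope_with K \<phi>" and K: "0 < K"
  shows "round_H_sections_with (1 / (K + 1)) \<phi>"
  unfolding round_H_sections_with_iff
proof (intro allI ballI impI)
  fix \<xi> :: "'n heis" and p s assume p: "p \<in> H_subdiff \<phi> \<xi>" and s: "(0::real) < s"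
  define E where "E = H_excess \<phi> \<xi> p"
  obtain q where q: "has_H_gradient \<phi> q \<xi>"
    using slope unfolding controlled_H_slope_with_def H_differentiable_def by blast
  have grad: "H_gradient \<phi> \<xi> = p"
    using p H_gradient_eqI[OF q] H_subdiff_eq_gradient[OF \<phi> q] by simp
  have cont: "continuous_on A E" for A unfolding E_def by (rule continuous_on_H_excess[OF \<phi>])
  have E0: "0 \<le> E v" for v unfolding E_def by (rule H_excess_nonneg[OF p])
  define \<Omega> where "\<Omega> = {v. E v < s}"
  have "bounded \<Omega>"
    using bd p s bounded_H_section unfolding bounded_H_sections_def \<Omega>_def E_def by blast
  moreover have "0 \<in> \<Omega>" using s by (simp add: \<Omega>_def E_def)
  ultimately obtain v0 where v0: "v0 \<in> closure \<Omega>" "\<And>v. v \<in> closure \<Omega> \<Longrightarrow> norm v \<le> norm v0"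
    using continuous_attains_sup[of "closure \<Omega>" norm, OF _ _ continuous_on_norm_id]
    by (metis closure_eq_empty compact_closure empty_iff)
  define R where "R = norm v0"
  have \<Omega>R: "norm v \<le> R" if "E v < s" for v
    using v0(2)[of v] that closure_subset[of \<Omega>] by (auto simp: R_def \<Omega>_def)
  have "closed {v. E v \<le> s}"
    using cont by (intro closed_Collect_le) auto
  then have "closure \<Omega> \<subseteq> {v. E v \<le> s}" by (intro closure_minimal) (auto simp: \<Omega>_def)
  then have Ev0: "E v0 \<le> s" using v0 by auto
  \<comment> \<open>An open set around 0 contains a vector of positive length, which makes
    \<open>R\<close> positive.\<close>
  have "open \<Omega>" unfolding \<Omega>_def using cont by (intro open_Collect_less) auto
  then obtain e where e: "0 < e" "cball 0 e \<subseteq> \<Omega>"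
    using \<open>0 \<in> \<Omega>\<close> open_contains_cball by blast
  obtain w :: "'n hlayer" where w: "norm w = e"
    by (metis vector_choose_size less_imp_le e(1))
  then have "w \<in> \<Omega>" using e(2) by (metis mem_cball_0 order_refl subsetD)
  then have R: "0 < R" using e w \<Omega>R[of w] by (simp add: \<Omega>_def)
  have "m_H \<phi> \<xi> R \<le> E v0"
    unfolding m_H_eq grad E_def[symmetric] using E0
    by (intro cINF_lower bdd_belowI2[of _ 0]) (auto simp: R_def)
  moreover have "E u \<le> M_H \<phi> \<xi> R" if "norm u = R" for u
    unfolding M_H_eq grad E_def[symmetric]
    using that cont by (intro cSUP_upper bounded_imp_bdd_above compact_imp_bounded compact_continuous_image) auto
  moreover have "M_H \<phi> \<xi> R \<le> K * m_H \<phi> \<xi> R"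
    using slope R unfolding controlled_H_slope_with_def by blast
  ultimately have EK: "E u \<le> K * s" if "norm u = R" for u
    using that Ev0 K by (smt (verit) mult_left_mono)
  have "E v < s" if v: "norm v \<le> 1 / (K + 1) * R" for v
  proof (cases "v = 0")
    case False
    define l where "l = norm v / R"
    have l: "0 \<le> l" "l \<le> 1 / (K + 1)" using v R by (simp_all add: l_def divide_le_eq)
    moreover have "1 / (K + 1) \<le> 1" using K by simp
    ultimately have "l \<le> 1" by linarith
    have "v = l *\<^sub>R ((R / norm v) *\<^sub>R v)" using R False by (simp add: l_def)
    then have "E v \<le> l * E ((R / norm v) *\<^sub>R v)"
      using H_excess_scale[OF \<phi> l(1) \<open>l \<le> 1\<close>, of \<xi> p "(R / norm v) *\<^sub>R v"] by (simp add: E_def)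
    also have "\<dots> \<le> 1 / (K + 1) * (K * s)"
      using l EK[of "(R / norm v) *\<^sub>R v"] E0 R False K by (intro mult_mono) auto
    also have "\<dots> < s" using K s by (simp add: divide_less_eq algebra_simps)
    finally show ?thesis .
  qed (use s in \<open>simp add: E_def\<close>)
  then show "\<exists>R>0. (\<forall>v. norm v \<le> 1 / (K + 1) * R \<longrightarrow> H_excess \<phi> \<xi> p v < s) \<and>
      (\<forall>v. H_excess \<phi> \<xi> p v < s \<longrightarrow> norm v \<le> R)"
    using R \<Omega>R unfolding E_def by blast
qed

section \<open>Round sections imply controlled slope\<close>

lemma round_imp_bounded:
  fixes \<phi> :: "'n::finite heis \<Rightarrow> real"
  assumes "round_H_sections_with K \<phi>"
  shows "bounded_H_sections \<phi>"
  unfolding bounded_H_sections_def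
proof (intro allI ballI impI)
  fix \<xi> :: "'n heis" and p s assume "p \<in> H_subdiff \<phi> \<xi>" "(0::real) < s"
  then obtain R where "\<And>v. H_excess \<phi> \<xi> p v < s \<Longrightarrow> norm v \<le> R"
    using assms unfolding round_H_sections_with_iff by blast
  then have "H_section \<phi> \<xi> p s \<subseteq> {\<zeta> \<odot> hexp v |\<zeta> v. \<zeta> \<in> {\<xi>} \<and> norm v \<le> R}"
    unfolding H_section_eq by blast
  then show "bounded (H_section \<phi> \<xi> p s)"
    using bounded_horizontal_neighbourhood[of "{\<xi>}" R] bounded_subset by auto
qed

text \<open>For any level \<open>s\<close> above the excess at \<open>w\<close>, the section
  contains \<open>w\<close>; hence \<open>norm w \<le> R\<close> and \<open>u\<close> lies in the
  inner ball. The arguments below use roundness only in this form.\<close>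

lemma round_H_excess_le:
  assumes round: "round_H_sections_with K \<phi>" and p: "p \<in> H_subdiff \<phi> \<xi>"
    and K: "0 \<le> K" and u: "norm u \<le> K * norm w"
  shows "H_excess \<phi> \<xi> p u \<le> H_excess \<phi> \<xi> p w"
proof (rule dense_ge)
  fix s assume s: "H_excess \<phi> \<xi> p w < s"
  then have "0 < s" using H_excess_nonneg[OF p, of w] by linarith
  then obtain R where R: "\<And>v. norm v \<le> K * R \<Longrightarrow> H_excess \<phi> \<xi> p v < s"
      "\<And>v. H_excess \<phi> \<xi> p v < s \<Longrightarrow> norm v \<le> R"
    using round p unfolding round_H_sections_with_iff by blast
  have "norm u \<le> K * R" using R(2)[OF s] u K mult_left_mono order_trans by blast
  then show "H_excess \<phi> \<xi> p u \<le> s" using R(1) less_imp_le by blast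
qed

text \<open>
  A subgradient that is exact in direction \<open>v\<close> makes the excess \<open>o(t)\<close> along \<open>v\<close>, whereas along
  \<open>- v\<close> it would grow linearly if \<open>v\<close> were a direction of non-differentiability.
\<close>

lemma round_dirderiv_minus:
  fixes \<phi> :: "'n::finite heis \<Rightarrow> real"
  assumes \<phi>: "H_convex \<phi>" and round: "round_H_sections_with K \<phi>" and K: "0 < K"
  shows "H_dirderiv \<phi> \<xi> v + H_dirderiv \<phi> \<xi> (- v) \<le> 0"
proof (rule ccontr)
  define \<delta> where "\<delta> = H_dirderiv \<phi> \<xi> v + H_dirderiv \<phi> \<xi> (- v)"
  assume "\<not> ?thesis"
  then have \<delta>: "0 < \<delta>" by (simp add: \<delta>_def)
  obtain p where p: "p \<in> H_subdiff \<phi> \<xi>" "p \<bullet> v = H_dirderiv \<phi> \<xi> v"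
    using H_subdiff_attains_dirderiv[OF \<phi>] by blast
  \<comment> \<open>The slack \<open>K * \<delta>\<close> matches the comparison: at the length
    factor \<open>t * K\<close> along \<open>- v\<close> the excess is at least
    \<open>t * K * \<delta>\<close>.\<close>
  have "H_dirderiv \<phi> \<xi> v < H_dirderiv \<phi> \<xi> v + K * \<delta>" using K \<delta> by simp
  then obtain t where t: "0 < t" "\<phi> (\<xi> \<odot> hexp (t *\<^sub>R v)) - \<phi> \<xi> < t * (H_dirderiv \<phi> \<xi> v + K * \<delta>)"
    using H_dirderiv_less[OF \<phi>] by (metis order_refl)
  have "H_excess \<phi> \<xi> p (t *\<^sub>R v) < t * K * \<delta>"
    using t p(2) by (simp add: H_excess_def algebra_simps)
  moreover have "t * K * \<delta> \<le> H_excess \<phi> \<xi> p ((t * K) *\<^sub>R (- v))"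
    using H_dirderiv_le[OF \<phi>, of "t * K" \<xi> "- v"] t K p(2)
    by (simp add: H_excess_def \<delta>_def algebra_simps)
  moreover have "H_excess \<phi> \<xi> p ((t * K) *\<^sub>R (- v)) \<le> H_excess \<phi> \<xi> p (t *\<^sub>R v)"
    using t K by (intro round_H_excess_le[OF round p(1)]) (auto simp: abs_mult)
  ultimately show False by linarith
qed

text \<open>Any subgradient \<open>p\<close> gives \<open>- (p \<bullet> v) \<le> H_dirderiv \<phi>
  \<xi> (- v) \<le> - H_dirderiv \<phi> \<xi> v\<close>, so the directional derivative lies below
  \<open>p\<close>.\<close>

lemma round_imp_H_differentiable:
  fixes \<phi> :: "'n::finite heis \<Rightarrow> real"
  assumes \<phi>: "H_convex \<phi>" and round: "round_H_sections_with K \<phi>" and K: "0 < K"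
  shows "H_differentiable \<phi>"
  unfolding H_differentiable_def
proof
  fix \<xi> :: "'n heis"
  obtain p where p: "p \<in> H_subdiff \<phi> \<xi>" using H_subdiff_attains_dirderiv[OF \<phi>] by blast
  have "H_dirderiv \<phi> \<xi> v \<le> p \<bullet> v" for v
    using round_dirderiv_minus[OF assms, of \<xi> v] p[unfolded H_subdiff_iff_dirderiv[OF \<phi>], rule_format, of "- v"]
    by simp
  then show "\<exists>p. has_H_gradient \<phi> p \<xi>" using has_H_gradientI[OF \<phi>] by blast
qed

text \<open>
  Roundness of the sections centred at the intermediate point \<open>\<eta>\<close> of the ray bounds the excess
  beyond \<open>\<eta>\<close> by the slope at \<open>\<eta>\<close>, and convexity bounds this slope by the excess a little further on.
\<close>

lemma round_H_excess_growth:
  fixes \<phi> :: "'n::finite heis \<Rightarrow> real"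
  assumes \<phi>: "H_convex \<phi>" and round: "round_H_sections_with K \<phi>" and K: "0 < K"
    and p: "p \<in> H_subdiff \<phi> \<xi>"
  shows "H_excess \<phi> \<xi> p ((1 + K) *\<^sub>R v) \<le> 2 * (1 + K) / K * H_excess \<phi> \<xi> p ((1 + K / 2) *\<^sub>R v)"
proof -
  define \<eta> where "\<eta> = \<xi> \<odot> hexp v"
  obtain q where q: "q \<in> H_subdiff \<phi> \<eta>" using H_subdiff_attains_dirderiv[OF \<phi>] by blast
  have \<eta>: "\<eta> \<odot> hexp (t *\<^sub>R v) = \<xi> \<odot> hexp ((1 + t) *\<^sub>R v)" for t
    using hmult_hexp_add[of \<xi> 1 v t] by (simp add: \<eta>_def)
  \<comment> \<open>The step \<open>- v\<close> leads from \<eta> back to \<xi>, and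
    \<open>K *\<^sub>R v\<close> is \<open>K\<close> times as long.\<close>
  have "H_excess \<phi> \<eta> q (K *\<^sub>R v) \<le> H_excess \<phi> \<eta> q ((-1) *\<^sub>R v)"
    using K by (intro round_H_excess_le[OF round q]) auto
  then have 1: "H_excess \<phi> \<xi> p ((1 + K) *\<^sub>R v) \<le> (1 + K) * (q \<bullet> v - p \<bullet> v)"
    unfolding H_excess_def \<eta> by (simp add: hmult_hunit algebra_simps)
  \<comment> \<open>Stopping at \<open>K / 2\<close>, strictly short of \<open>K\<close>, compares
    two points of the ray whose ratio exceeds 1, so that the estimate can be iterated.\<close>
  have "0 \<le> H_excess \<phi> \<eta> q ((K / 2) *\<^sub>R v)" by (rule H_excess_nonneg[OF q])
  moreover have "0 \<le> H_excess \<phi> \<xi> p v" by (rule H_excess_nonneg[OF p])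
  ultimately have "K / 2 * (q \<bullet> v - p \<bullet> v) \<le> H_excess \<phi> \<xi> p ((1 + K / 2) *\<^sub>R v)"
    unfolding H_excess_def \<eta> by (simp add: algebra_simps flip: \<eta>_def)
  then have "q \<bullet> v - p \<bullet> v \<le> 2 / K * H_excess \<phi> \<xi> p ((1 + K / 2) *\<^sub>R v)"
    using K by (simp add: field_simps)
  then have "(1 + K) * (q \<bullet> v - p \<bullet> v) \<le> (1 + K) * (2 / K * H_excess \<phi> \<xi> p ((1 + K / 2) *\<^sub>R v))"
    using K by (intro mult_left_mono) auto
  also have "\<dots> = 2 * (1 + K) / K * H_excess \<phi> \<xi> p ((1 + K / 2) *\<^sub>R v)"
    by (simp add: field_simps)
  finally show ?thesis using 1 by linarith
qed

text \<open>Given \<open>u\<close> and \<open>w\<close> on one sphere, \<open>m\<close> shrinkings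
  bring \<open>u\<close> to norm at most \<open>K * norm w\<close>, where roundness compares it with
  \<open>w\<close>. The growth estimate applied \<open>m\<close> times leads back to
  \<open>u\<close>.\<close>

lemma round_imp_controlled:
  fixes \<phi> :: "'n::finite heis \<Rightarrow> real"
  assumes \<phi>: "H_convex \<phi>" and round: "round_H_sections_with K \<phi>" and K: "0 < K"
    and m: "1 / K \<le> ((1 + K) / (1 + K / 2)) ^ m"
  shows "controlled_H_slope_with ((2 * (1 + K) / K) ^ m) \<phi>"
proof -
  define \<theta> C where "\<theta> = (1 + K) / (1 + K / 2)" and "C = 2 * (1 + K) / K"
  have \<theta>: "0 < \<theta>" and C: "0 < C" using K by (simp_all add: \<theta>_def C_def)
  have diff: "H_differentiable \<phi>" by (rule round_imp_H_differentiable[OF \<phi> round K])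
  have "M_H \<phi> \<xi> r \<le> C ^ m * m_H \<phi> \<xi> r" if r: "0 < r" for \<xi> r
  proof -
    obtain p where p: "has_H_gradient \<phi> p \<xi>" using diff unfolding H_differentiable_def by blast
    then have grad: "H_gradient \<phi> \<xi> = p" by (rule H_gradient_eqI)
    have p: "p \<in> H_subdiff \<phi> \<xi>" using H_subdiff_eq_gradient[OF \<phi> p] by simp
    define E where "E = H_excess \<phi> \<xi> p"
    have ne: "sphere (0::'n hlayer) r \<noteq> {}" using r vector_choose_size[of r] by force
    have step: "E (\<theta> *\<^sub>R v) \<le> C * E v" for v
      using round_H_excess_growth[OF \<phi> round K p, of "(1 / (1 + K / 2)) *\<^sub>R v"] K
      by (simp add: E_def \<theta>_def C_def)
    have iter: "E (\<theta> ^ k *\<^sub>R v) \<le> C ^ k * E v" for k v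
    proof (induction k)
      case (Suc k)
      have "E (\<theta> ^ Suc k *\<^sub>R v) \<le> C * E (\<theta> ^ k *\<^sub>R v)" using step[of "\<theta> ^ k *\<^sub>R v"] by simp
      also have "\<dots> \<le> C * (C ^ k * E v)" using Suc C by (intro mult_left_mono) auto
      finally show ?case by (simp add: mult.assoc)
    qed simp
    have le: "E u \<le> C ^ m * E w" if "norm u = r" "norm w = r" for u w
    proof -
      define v where "v = (1 / \<theta> ^ m) *\<^sub>R u"
      have "1 / \<theta> ^ m \<le> K" using m[folded \<theta>_def] K \<theta> by (simp add: pos_divide_le_eq mult.commute)
      then have "norm v \<le> K * norm w"
        using that r \<theta> mult_right_mono[of "1 / \<theta> ^ m" K r] by (simp add: v_def)
      then have "E v \<le> E w" unfolding E_def using K by (intro round_H_excess_le[OF round p]) auto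
      then have "C ^ m * E v \<le> C ^ m * E w" using C by (intro mult_left_mono) auto
      then show ?thesis using iter[of m v] \<theta> by (simp add: v_def)
    qed
    have "E u \<le> C ^ m * (INF w\<in>sphere 0 r. E w)" if "norm u = r" for u
    proof -
      have "E u / C ^ m \<le> (INF w\<in>sphere 0 r. E w)"
        using ne le[OF that] C by (intro cINF_greatest) (auto simp: divide_le_eq mult.commute)
      then show ?thesis using C by (simp add: divide_le_eq mult.commute)
    qed
    then show ?thesis
      unfolding M_H_eq m_H_eq grad E_def[symmetric] using ne by (intro cSUP_least) auto
  qed
  then show ?thesis
    using diff unfolding controlled_H_slope_with_def C_def by blast
qed

section \<open>The equivalence and the relation between the constants\<close>

theorem theorem3p1:
  "(\<forall>\<phi> :: 'n::finite heis \<Rightarrow> real. H_convex \<phi> \<longrightarrow>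
      (H_differentiable \<phi> \<and> bounded_H_sections \<phi> \<and> controlled_H_slope \<phi>
        \<longleftrightarrow> round_H_sections \<phi>)) \<and>
   (\<exists>F G :: real \<Rightarrow> real.
      (\<forall>K1>0. 0 < F K1 \<and> F K1 < 1) \<and>
      (\<forall>K0. 0 < K0 \<and> K0 < 1 \<longrightarrow> 0 < G K0) \<and>
      (\<forall>\<phi> :: 'n heis \<Rightarrow> real. H_convex \<phi> \<longrightarrow>
        (\<forall>K1>0. H_differentiable \<phi> \<and> bounded_H_sections \<phi> \<and> controlled_H_slope_with K1 \<phi>
           \<longrightarrow> round_H_sections_with (F K1) \<phi>) \<and>
        (\<forall>K0. 0 < K0 \<and> K0 < 1 \<and> round_H_sections_with K0 \<phi>
           \<longrightarrow> controlled_H_slope_with (G K0) \<phi>)))"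
proof -
  define F :: "real \<Rightarrow> real" where "F K = 1 / (K + 1)" for K
  have F: "0 < F K" "F K < 1" if "0 < K" for K using that by (simp_all add: F_def)
  \<comment> \<open>The base exceeds 1, so some power passes \<open>1 / K\<close>; the exponent is
    fixed by \<open>K\<close> before any \<phi> is chosen.\<close>
  have "\<exists>m. 1 / K \<le> ((1 + K) / (1 + K / 2)) ^ m" if "0 < K" for K :: real
    using real_arch_pow[of "(1 + K) / (1 + K / 2)" "1 / K"] that by (auto intro: less_imp_le)
  then obtain m where m: "\<And>K::real. 0 < K \<Longrightarrow> 1 / K \<le> ((1 + K) / (1 + K / 2)) ^ m K"
    by metis
  define G :: "real \<Rightarrow> real" where "G K = (2 * (1 + K) / K) ^ m K" for K
  have G: "0 < G K" if "0 < K" for K using that by (simp add: G_def)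
  have ab: "round_H_sections_with (F K) \<phi>"
    if "H_convex \<phi>" "bounded_H_sections \<phi>" "controlled_H_slope_with K \<phi>" "0 < K" for K and \<phi> :: "'n heis \<Rightarrow> real"
    unfolding F_def using controlled_imp_round[OF that] .
  have ba: "controlled_H_slope_with (G K) \<phi>"
    if "H_convex \<phi>" "round_H_sections_with K \<phi>" "0 < K" for K and \<phi> :: "'n heis \<Rightarrow> real"
    unfolding G_def using round_imp_controlled[OF that m[OF that(3)]] .
  have "H_differentiable \<phi> \<and> bounded_H_sections \<phi> \<and> controlled_H_slope \<phi> \<longleftrightarrow> round_H_sections \<phi>"
    if "H_convex \<phi>" for \<phi> :: "'n heis \<Rightarrow> real"
    unfolding controlled_H_slope_def round_H_sections_def
    using ab[OF that] ba[OF that] F G round_imp_bounded round_imp_H_differentiable[OF that] by metis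
  moreover have "\<exists>F G :: real \<Rightarrow> real.
      (\<forall>K1>0. 0 < F K1 \<and> F K1 < 1) \<and>
      (\<forall>K0. 0 < K0 \<and> K0 < 1 \<longrightarrow> 0 < G K0) \<and>
      (\<forall>\<phi> :: 'n heis \<Rightarrow> real. H_convex \<phi> \<longrightarrow>
        (\<forall>K1>0. H_differentiable \<phi> \<and> bounded_H_sections \<phi> \<and> controlled_H_slope_with K1 \<phi>
           \<longrightarrow> round_H_sections_with (F K1) \<phi>) \<and>
        (\<forall>K0. 0 < K0 \<and> K0 < 1 \<and> round_H_sections_with K0 \<phi>
           \<longrightarrow> controlled_H_slope_with (G K0) \<phi>))"
    using ab ba F G
    by (intro exI[of _ F] exI[of _ G] conjI allI impI) simp_all
  ultimately show ?thesis by blast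
qed

end
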